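(* Let $n$ be a positive odd integer, and let $M=(n-1)/2$ or $M=n-1$. Then $$\sum_{k=0}^{M}[4k+1]\frac{(q;q^2)_k^6}{(q^2;q^2)_k^6}q^k\equiv[n]q^{(1-n)/2}\left\{1+[n]^2\frac{(n^2-1)(1-q)^2}{24}\right\}\sum_{k=0}^{(n-1)/2}\frac{(q;q^2)_k^4}{(q^2;q^2)_k^4}q^{2k}\pmod{[n]\Phi_n(q)^3}.$$
   Context: For a nonnegative integer $k$, $(x;q)_0=1$ and $(x;q)_k=(1-x)(1-xq)\cdots(1-xq^{k-1})$ for $k\ge 1$; the same notation is used with base $q$ replaced by $q^2$. $[m]=(1-q^m)/(1-q)$, and $\Phi_n(q)$ is the $n$-th cyclotomic polynomial in $q$. For rational functions $A,B\in\mathbb{Q}(q)$ and a polynomial $P\in\mathbb{Q}[q]$, $A\equiv B\pmod P$ means that $A-B$, written in lowest terms, has numerator divisible by $P$. *)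

theory Defs
  imports Complex_Main "HOL-Computational_Algebra.Computational_Algebra"
    "HOL-Computational_Algebra.Field_as_Ring"
begin

type_synonym ratfun = "rat poly fract"

abbreviation qvar :: ratfun where
  "qvar \<equiv> to_fract (monom 1 1)"

text \<open>
  The shifted factorial \<open>(x; b)\<^sub>k\<close>.
\<close>
definition q_poch :: "'a::comm_ring_1 \<Rightarrow> 'a \<Rightarrow> nat \<Rightarrow> 'a" where
  "q_poch x b k = (\<Prod>i<k. 1 - x * b ^ i)"

text \<open>
  The base \<open>x\<close> is taken either in \<open>ratfun\<close>, where \<^const>\<open>divide\<close> is division in the field, or in
  \<open>rat poly\<close>, where the division is exact; \<open>to_fract_q_int\<close> below shows that the two agree.
\<close>
definition q_int :: "'a::idom_divide \<Rightarrow> nat \<Rightarrow> 'a" where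
  "q_int x m = (1 - x ^ m) div (1 - x)"

definition primitive_unity_roots :: "nat \<Rightarrow> complex set" where
  "primitive_unity_roots n = {z. z ^ n = 1 \<and> (\<forall>m. 0 < m \<and> m < n \<longrightarrow> z ^ m \<noteq> 1)}"

text \<open>
  For \<open>n > 0\<close> such a rational polynomial exists and is unique, see \<open>of_rat_cyclotomic\<close>; no
  meaning is attached to \<open>cyclotomic 0\<close>.
\<close>
definition cyclotomic :: "nat \<Rightarrow> rat poly" where
  "cyclotomic n = (THE p. map_poly of_rat p = (\<Prod>z\<in>primitive_unity_roots n. [:-z, 1:]))"

text \<open>
  The first component of \<^const>\<open>quot_of_fract\<close> is the numerator in lowest terms.
\<close>
definition ratfun_cong :: "ratfun \<Rightarrow> ratfun \<Rightarrow> rat poly \<Rightarrow> bool" where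
  "ratfun_cong A B P \<longleftrightarrow> P dvd fst (quot_of_fract (A - B))"

lemma to_fract_power: "to_fract (p ^ k) = to_fract p ^ k"
  by (induction k) simp_all

lemma one_minus_monom_neq_0: "1 - monom 1 1 \<noteq> (0 :: rat poly)"
proof
  assume "1 - monom 1 1 = (0 :: rat poly)"
  hence "coeff (1 - monom 1 1 :: rat poly) 1 = 0" by simp
  thus False by simp
qed

lemma q_int_eq_sum:
  fixes x :: "'a::idom_divide"
  assumes "1 - x \<noteq> 0"
  shows "q_int x m = (\<Sum>i<m. x ^ i)"
  using assms unfolding q_int_def one_diff_power_eq by simp

lemma to_fract_q_int: "to_fract (q_int (monom 1 1) m) = q_int qvar m"
proof -
  have "to_fract (1 - monom 1 1 :: rat poly) \<noteq> 0"
    by (subst to_fract_eq_0_iff) (rule one_minus_monom_neq_0)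
  hence "1 - qvar \<noteq> 0" by simp
  thus ?thesis
    by (simp only: q_int_eq_sum one_minus_monom_neq_0 to_fract_power to_fract_sum not_False_eq_True)
qed

lemma finite_primitive_unity_roots:
  assumes "n > 0"
  shows "finite (primitive_unity_roots n)"
  by (rule finite_subset[OF _ finite_roots_unity[of n]])
     (use assms in \<open>auto simp: primitive_unity_roots_def\<close>)

lemma unity_roots_eq_UN:
  assumes "n > 0"
  shows "{z::complex. z ^ n = 1} = (\<Union>d\<in>{d. d dvd n}. primitive_unity_roots d)"
proof (intro equalityI subsetI)
  fix z :: complex assume "z \<in> {z. z ^ n = 1}"
  hence z: "z ^ n = 1" by simp
  define d where "d = (LEAST d. d > 0 \<and> z ^ d = 1)"
  have d: "d > 0 \<and> z ^ d = 1"
    unfolding d_def by (rule LeastI[of _ n]) (use assms z in auto)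
  have least: "z ^ m \<noteq> 1" if "0 < m" "m < d" for m
    using not_less_Least[of m "\<lambda>d. d > 0 \<and> z ^ d = 1"] that by (auto simp: d_def)
  have "z ^ (n mod d) = z ^ (d * (n div d) + n mod d)"
    using d by (simp only: power_add power_mult) simp
  hence "z ^ (n mod d) = 1" using z by simp
  hence "d dvd n"
    using least[of "n mod d"] d by (metis mod_eq_0_iff_dvd mod_less_divisor neq0_conv)
  thus "z \<in> (\<Union>d\<in>{d. d dvd n}. primitive_unity_roots d)"
    using d least by (auto simp: primitive_unity_roots_def)
next
  fix z :: complex assume "z \<in> (\<Union>d\<in>{d. d dvd n}. primitive_unity_roots d)"
  thus "z \<in> {z. z ^ n = 1}"
    by (auto simp: primitive_unity_roots_def power_mult elim!: dvdE)
qed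

lemma disjoint_primitive_unity_roots:
  assumes "d > 0" "e > 0" "d \<noteq> e"
  shows "primitive_unity_roots d \<inter> primitive_unity_roots e = {}"
  using assms by (auto simp: primitive_unity_roots_def) (metis linorder_neqE_nat)

lemma prod_unity_roots:
  assumes "n > 0"
  shows "(\<Prod>z | z ^ n = 1. [:-z, 1:]) = monom 1 n - (1 :: complex poly)"
proof -
  let ?P = "\<Prod>z | z ^ n = 1. [:-z, 1:] :: complex poly"
  let ?Q = "monom 1 n - (1 :: complex poly)"
  have fin: "finite {z::complex. z ^ n = 1}"
    using assms by (intro finite_roots_unity) auto
  have degP: "degree ?P = n"
    by (subst degree_prod_eq_sum_degree) (use assms in \<open>auto simp: card_roots_unity_eq\<close>)
  have lcP: "coeff ?P n = 1"
    using lead_coeff_prod[of "\<lambda>z::complex. [:-z, 1:]" "{z. z ^ n = 1}"] degP by simp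
  show ?thesis
  proof (rule ccontr)
    assume neq: "?P \<noteq> ?Q"
    have "degree ?Q \<le> n" by (intro degree_diff_le) (auto simp: degree_monom_le)
    hence "degree (?P - ?Q) \<le> n" using degP by (intro degree_diff_le[of ?P n ?Q]) simp_all
    moreover have "coeff (?P - ?Q) n = 0" using lcP assms by simp
    ultimately have deg: "degree (?P - ?Q) < n"
      using neq by (metis eq_iff_diff_eq_0 le_neq_implies_less leading_coeff_0_iff)
    have "n = card {z::complex. z ^ n = 1}" using assms by (simp add: card_roots_unity_eq)
    also have "\<dots> \<le> card {z. poly (?P - ?Q) z = 0}"
      using neq fin by (intro card_mono poly_roots_finite)
        (auto simp: poly_prod poly_monom intro!: prod_zero)
    also have "\<dots> \<le> degree (?P - ?Q)" using neq by (intro card_poly_roots_bound) auto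
    finally show False using deg by simp
  qed
qed

lemma prod_primitive_unity_roots:
  assumes "n > 0"
  shows "(\<Prod>d | d dvd n. \<Prod>z\<in>primitive_unity_roots d. [:-z, 1:]) = monom 1 n - (1 :: complex poly)"
proof -
  have pos: "d > 0" if "d dvd n" for d using that assms by (auto intro: Nat.gr0I)
  have "(\<Prod>z | z ^ n = 1. [:-z, 1:] :: complex poly)
      = (\<Prod>d | d dvd n. \<Prod>z\<in>primitive_unity_roots d. [:-z, 1:])"
    unfolding unity_roots_eq_UN[OF assms]
    by (rule prod.UNION_disjoint)
       (use assms pos in \<open>auto simp: finite_primitive_unity_roots dest!: disjoint_primitive_unity_roots[rotated 2]\<close>)
  thus ?thesis using prod_unity_roots[OF assms] by simp
qed

lemma map_poly_of_rat_diff: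
  "map_poly of_rat (p - r) = (map_poly of_rat p - map_poly of_rat r :: complex poly)"
  by (rule poly_eqI) (simp add: coeff_map_poly of_rat_diff)

lemma map_poly_of_rat_mult:
  "map_poly of_rat (p * r) = (map_poly of_rat p * map_poly of_rat r :: complex poly)"
  by (rule poly_eqI) (simp add: coeff_map_poly coeff_mult of_rat_sum of_rat_mult)

lemma map_poly_of_rat_prod:
  "map_poly of_rat (\<Prod>i\<in>A. f i) = (\<Prod>i\<in>A. map_poly of_rat (f i) :: complex poly)"
  by (induction A rule: infinite_finite_induct) (simp_all add: map_poly_of_rat_mult)

lemma map_poly_of_rat_inj:
  assumes "map_poly of_rat p = (map_poly of_rat r :: complex poly)"
  shows "p = r"
  by (rule poly_eqI) (use arg_cong[OF assms, of "\<lambda>p. coeff p _"] in \<open>simp add: coeff_map_poly\<close>)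

lemma map_poly_of_rat_exists:
  assumes "n > 0"
  shows "\<exists>p. map_poly of_rat p = (\<Prod>z\<in>primitive_unity_roots n. [:-z, 1:])"
  using assms
proof (induction n rule: less_induct)
  case (less n)
  define C where "C = (\<lambda>d. \<Prod>z\<in>primitive_unity_roots d. [:-z, 1:])"
  define D where "D = {d. d dvd n} - {n}"
  have D: "d < n \<and> d > 0" if "d \<in> D" for d
    using that less.prems by (auto simp: D_def dest: dvd_imp_le intro: Nat.gr0I)
  have "\<exists>p. map_poly of_rat p = C d" if "d \<in> D" for d
    using less.IH D[OF that] by (auto simp: C_def)
  then obtain f where f: "\<And>d. d \<in> D \<Longrightarrow> map_poly of_rat (f d) = C d" by metis
  define Q where "Q = (\<Prod>d\<in>D. f d)"
  define X where "X = monom 1 n - (1 :: rat poly)"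
  have Q: "map_poly of_rat Q = (\<Prod>d\<in>D. C d)"
    unfolding Q_def map_poly_of_rat_prod by (intro prod.cong f refl)
  have "(\<Prod>d | d dvd n. C d) = C n * (\<Prod>d\<in>D. C d)"
    unfolding D_def using less.prems by (subst prod.remove[of _ n]) auto
  moreover have "map_poly of_rat X = monom 1 n - (1 :: complex poly)"
    unfolding X_def map_poly_of_rat_diff by (simp add: map_poly_monom)
  ultimately have X: "map_poly of_rat X = C n * map_poly of_rat Q"
    using prod_primitive_unity_roots[OF less.prems] Q by (simp add: C_def)
  have "lead_coeff (map_poly of_rat Q :: complex poly) = 1"
    unfolding Q C_def by (simp add: lead_coeff_prod)
  hence Q0: "map_poly of_rat Q \<noteq> (0 :: complex poly)" by auto
  hence "Q \<noteq> 0" by auto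
  have deg: "degree (map_poly of_rat p :: complex poly) = degree p" for p :: "rat poly"
    by (rule degree_map_poly) simp
  have "map_poly of_rat (X mod Q) = map_poly of_rat Q * (C n - map_poly of_rat (X div Q))"
    using X by (simp add: minus_div_mult_eq_mod [symmetric] map_poly_of_rat_diff
        map_poly_of_rat_mult algebra_simps)
  moreover have "X mod Q = 0 \<or> degree (X mod Q) < degree Q"
    using \<open>Q \<noteq> 0\<close> by (rule degree_mod_less)
  ultimately have "C n - map_poly of_rat (X div Q) = 0"
    using Q0 deg[of "X mod Q"] deg[of Q]
    by (metis degree_mult_eq map_poly_0 mult_eq_0_iff not_add_less1)
  thus ?case by (auto simp: C_def)
qed

lemma of_rat_cyclotomic:
  assumes "n > 0"
  shows "map_poly of_rat (cyclotomic n) = (\<Prod>z\<in>primitive_unity_roots n. [:-z, 1:])"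
  unfolding cyclotomic_def
  by (rule theI') (use map_poly_of_rat_exists[OF assms] map_poly_of_rat_inj in metis)

lemma prod_cyclotomic:
  assumes "n > 0"
  shows "(\<Prod>d | d dvd n. cyclotomic d) = monom 1 n - 1"
proof (rule map_poly_of_rat_inj)
  have "d > 0" if "d dvd n" for d using that assms by (auto intro: Nat.gr0I)
  hence "map_poly of_rat (\<Prod>d | d dvd n. cyclotomic d)
      = (\<Prod>d | d dvd n. \<Prod>z\<in>primitive_unity_roots d. [:-z, 1:])"
    unfolding map_poly_of_rat_prod by (intro prod.cong of_rat_cyclotomic) auto
  thus "map_poly of_rat (\<Prod>d | d dvd n. cyclotomic d)
      = (map_poly of_rat (monom 1 n - 1) :: complex poly)"
    using prod_primitive_unity_roots[OF assms]
    by (simp add: map_poly_of_rat_diff map_poly_monom)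
qed

end

(*
  Congruences modulo products of cyclotomic polynomials are checked at every complex root of unity z, as
  orders of vanishing.

  Let z be primitive of order n = 2N+1, x = q^n and h = x - 1. Replace three of the six parameters q of the
  very-well-poised series by q/x, q y, q x/y, where y + x/y = x + 1 - h^2. Every factor (1-c)^3 then changes
  by a multiple of g = h^3/x, so modulo the fourth power of q - z the sum changes by g times a sum which
  vanishes at z, because its terms are antisymmetric under k -> N-k. The perturbed series terminates, and
  Watson's transformation evaluates it as the right-hand 4phi3 (unperturbed up to order h^3) times
    (1-x)/(1-q) q^(-N) prod_{i=1..N} 1/(1 + h^2 c_i),   c_i = e/(x(1-e)(1-e/x)),  e = q^(2i).
  At z the c_i sum to -(n^2-1)/24, whence the correction term.

  If z has order d < n, one zero is enough: the sum splits into blocks of length d, each of which is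
  a multiple of the first one at z, and that vanishes by the same antisymmetry.
*)
theory Submission
  imports Defs
begin

subsection \<open>Saalschuetz summation and a Watson transformation\<close>

text \<open>The required precision dictates the perturbation. The modulus has zeros at the n-th
  roots of unity other than 1, of order 4 at the primitive ones and of order 1 at the rest. Watson's
  transformation needs a numerator parameter q^(-2N), which is exactly q/x; but replacing one q by
  q/x alone would cost an error of first order in h. The companions q y and q x/y remove the errors
  of order one and two. The three parameters still have product q^3, so the argument q^k of the
  series does not change. What remains has order h^3, one short of what is needed, and the
  antisymmetry of the summands supplies the missing zero. On the evaluated side the factor 1 - x
  already has one zero, so there everything else is needed only to order 3. The choice M = n - 1
  makes no difference at a primitive root, because the terms beyond N contain the sixth power of 1 -
  q^n.\<close>

lemma q_poch_0 [simp]: "q_poch x b 0 = 1"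
  by (simp add: q_poch_def)

lemma q_poch_Suc: "q_poch x b (Suc k) = q_poch x b k * (1 - x * b ^ k)"
  by (simp add: q_poch_def)

lemma q_poch_add: "q_poch x b (m + k) = q_poch x b m * q_poch (x * b ^ m) b k"
  by (induction k) (simp_all add: q_poch_Suc power_add algebra_simps)

text \<open>
  For \<open>w = A + B\<close> and \<open>c = A B\<close> this is \<open>(A; b)\<^sub>k (B; b)\<^sub>k\<close>; the pair \<open>A, B\<close> needed below does not
  exist in the field of rational functions.
\<close>
definition quad_poch :: "'a::comm_ring_1 \<Rightarrow> 'a \<Rightarrow> 'a \<Rightarrow> nat \<Rightarrow> 'a" where
  "quad_poch w c b k = (\<Prod>i<k. 1 - w * b ^ i + c * b ^ (2 * i))"

lemma quad_poch_0 [simp]: "quad_poch w c b 0 = 1"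
  by (simp add: quad_poch_def)

lemma quad_poch_Suc:
  "quad_poch w c b (Suc k) = quad_poch w c b k * (1 - w * b ^ k + c * b ^ (2 * k))"
  by (simp add: quad_poch_def)

lemma quad_poch_add:
  "quad_poch w c b (m + k) = quad_poch w c b m * quad_poch (w * b ^ m) (c * b ^ (2 * m)) b k"
  by (induction k) (simp_all add: quad_poch_Suc power_add power_mult power2_eq_square algebra_simps)

lemma q_poch_nonzero:
  fixes x :: "'a::idom"
  assumes "\<And>i. i < k \<Longrightarrow> x * b ^ i \<noteq> 1"
  shows "q_poch x b k \<noteq> 0"
  unfolding q_poch_def using assms by (metis (no_types, lifting) finite_lessThan lessThan_iff prod_zero_iff right_minus_eq)

text \<open>For w = A + B and c = A B this is the q-Pfaff-Saalschuetz sum, in the form obtained by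
  comparing coefficients of u^m in Heine's q-analogue of Euler's transformation, (D u; p)_inf / (u;
  p)_inf * 2phi1(A, B; C; D u) = 2phi1(C/A, C/B; C; u). Only symmetric functions of A and B occur,
  so the proof must do without the factorization.\<close>

lemma q_saalschuetz:
  fixes w c C D p :: "'a::field"
  assumes DC: "D * c = C"
    and p: "\<And>i. i > 0 \<Longrightarrow> p ^ i \<noteq> 1" and C: "\<And>i. C * p ^ i \<noteq> 1"
  shows "(\<Sum>j\<le>m. quad_poch w c p j * (D ^ j * q_poch D p (m - j)
            / (q_poch p p j * q_poch C p j * q_poch p p (m - j))))
         = quad_poch (D * w) (C * D) p m / (q_poch p p m * q_poch C p m)"
proof (induction m)
  case 0
  show ?case by simp
next
  case (Suc m)
  define s where "s = (\<lambda>m j. D ^ j * q_poch D p (m - j)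
            / (q_poch p p j * q_poch C p j * q_poch p p (m - j)))"
  define Q where "Q = quad_poch w c p"
  have pp [simp]: "q_poch p p k \<noteq> 0" for k
    using p[of "Suc _"] by (intro q_poch_nonzero) simp
  have CC [simp]: "q_poch C p k \<noteq> 0" for k
    using C by (intro q_poch_nonzero) simp
  have p1: "1 - p ^ Suc i \<noteq> 0" for i using p[of "Suc i"] by auto
  have C1: "1 - C * p ^ i \<noteq> 0" for i using C[of i] by auto
  define K where "K = (1 - p ^ Suc m) * (1 - C * p ^ m)"
  define u where "u = (\<lambda>j. if j \<le> m then s m j * (1 - p ^ (m - j) * D * (1 + p ^ (2 * j) * c)
      + p ^ (2 * m) * C * D) else 0)"
  define v where "v = (\<lambda>j. case j of 0 \<Rightarrow> 0 | Suc i \<Rightarrow> p ^ (m - i) * D * s m i)"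
  \<comment> \<open>\<open>r j l\<close> is \<open>s\<close> in the independent indices j and l = m
    - j; its recurrences \<open>r1\<close> and \<open>r2\<close> are free of truncated
    subtraction.\<close>
  define r where "r = (\<lambda>j l. D ^ j * q_poch D p l / (q_poch p p j * q_poch C p j * q_poch p p l))"
  have sr: "s (j + l) j = r j l" for j l by (simp add: s_def r_def)
  have r1: "r j (Suc l) * (1 - p * p ^ l) = r j l * (1 - D * p ^ l)" for j l
    using p1[of l] by (simp add: r_def q_poch_Suc mult_ac)
  have r2: "r (Suc i) l * ((1 - p * p ^ i) * (1 - C * p ^ i)) = D * r i l" for i l
    using p1[of i] C1[of i] by (simp add: r_def q_poch_Suc mult_ac)
  \<comment> \<open>Writing \<open>w * Q j\<close> as a combination of \<open>Q j\<close> and \<open>Q (Suc j)\<close> turns the recurrence in \<open>m\<close> into an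
    identity between the coefficients of each \<open>Q j\<close>.\<close>
  have UV: "K * s (Suc m) j = u j + v j" if jm: "j \<le> Suc m" for j
  proof (cases j)
    case 0
    have "K * r 0 (Suc m) = (1 - C * p ^ m) * (r 0 m * (1 - D * p ^ m))"
      unfolding r1[symmetric] K_def by simp
    also have "\<dots> = r 0 m * (1 - p ^ m * D * (1 + c) + (p ^ m)\<^sup>2 * C * D)"
      unfolding DC[symmetric] by algebra
    finally show ?thesis
      using sr[of 0 m] sr[of 0 "Suc m"] by (simp add: 0 u_def v_def power_mult[symmetric] mult.commute)
  next
    case (Suc i)
    show ?thesis
    proof (cases "i = m")
      case True
      have "K * r (Suc m) 0 = D * r m 0" unfolding r2[symmetric] K_def by simp
      thus ?thesis
        using sr[of "Suc m" 0] sr[of m 0] by (simp add: True Suc u_def v_def)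
    next
      case False
      then obtain l where m: "m = Suc i + l" using jm Suc
        by (metis Suc_le_mono le_neq_implies_less less_iff_Suc_add add_Suc)
      define a b where "a = p ^ i" and "b = p ^ l"
      have R1: "r (Suc i) (Suc l) * (1 - p * b) = r (Suc i) l * (1 - D * b)"
        unfolding b_def by (rule r1)
      have R2: "r (Suc i) (Suc l) * ((1 - p * a) * (1 - C * a)) = D * r i (Suc l)"
        unfolding a_def by (rule r2)
      \<comment> \<open>The factor 1 - p b makes \<open>R1\<close> applicable as a polynomial
        relation; it is nonzero and is cancelled afterwards.\<close>
      have "(1 - p * b) * ((1 - p * (p * a * b)) * (1 - C * (p * a * b)) * r (Suc i) (Suc l)
           - (r (Suc i) l * (1 - b * D * (1 + (p * a)\<^sup>2 * c) + (p * a * b)\<^sup>2 * C * D)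
              + p * b * D * r i (Suc l))) = 0"
        using R1 R2 DC by algebra
      hence "(1 - p * (p * a * b)) * (1 - C * (p * a * b)) * r (Suc i) (Suc l)
           = r (Suc i) l * (1 - b * D * (1 + (p * a)\<^sup>2 * c) + (p * a * b)\<^sup>2 * C * D)
              + p * b * D * r i (Suc l)"
        using p1[of l] by (simp add: b_def)
      moreover have "p ^ (2 * j) = (p * a)\<^sup>2" "p ^ (2 * m) = (p * a * b)\<^sup>2" "p ^ Suc m = p * (p * a * b)"
         "p ^ m = p * a * b" "p ^ (m - j) = b" "p ^ (m - i) = p * b"
        by (simp_all add: Suc m a_def b_def power_add power_mult[symmetric] power_mult_distrib mult_ac)
          (simp_all add: power2_eq_square)
      moreover have "s (Suc m) j = r (Suc i) (Suc l)" "s m j = r (Suc i) l" "s m i = r i (Suc l)"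
        using sr[of "Suc i" "Suc l"] sr[of "Suc i" l] sr[of i "Suc l"] by (simp_all add: Suc m)
      ultimately show ?thesis
        by (simp only: K_def u_def v_def Suc nat.case) (simp add: m)
    qed
  qed
  have "K * (\<Sum>j\<le>Suc m. Q j * s (Suc m) j) = (\<Sum>j\<le>Suc m. Q j * (K * s (Suc m) j))"
    by (simp only: sum_distrib_left mult_ac)
  also have "\<dots> = (\<Sum>j\<le>Suc m. Q j * u j) + (\<Sum>j\<le>Suc m. Q j * v j)"
    by (subst sum.distrib[symmetric], intro sum.cong refl) (simp add: UV algebra_simps)
  also have "(\<Sum>j\<le>Suc m. Q j * v j) = (\<Sum>j\<le>m. Q (Suc j) * v (Suc j))"
    by (subst sum.atMost_Suc_shift) (simp add: v_def)
  also have "(\<Sum>j\<le>Suc m. Q j * u j) = (\<Sum>j\<le>m. Q j * u j)"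
    by (simp add: u_def)
  also have "(\<Sum>j\<le>m. Q j * u j) + (\<Sum>j\<le>m. Q (Suc j) * v (Suc j))
     = (\<Sum>j\<le>m. Q j * s m j * (1 - p ^ m * D * w + p ^ (2 * m) * C * D))"
    unfolding sum.distrib[symmetric]
  proof (intro sum.cong refl)
    fix j assume "j \<in> {..m}"
    then obtain l where m: "m = j + l" by (auto simp: le_iff_add)
    show "Q j * u j + Q (Suc j) * v (Suc j)
        = Q j * s m j * (1 - p ^ m * D * w + p ^ (2 * m) * C * D)"
      by (simp add: u_def v_def Q_def quad_poch_Suc m)
         (simp add: power_add power_mult power2_eq_square algebra_simps)
  qed
  also have "\<dots> = quad_poch (D * w) (C * D) p m / (q_poch p p m * q_poch C p m)
      * (1 - p ^ m * D * w + p ^ (2 * m) * C * D)"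
    using Suc.IH unfolding sum_distrib_right[symmetric] Q_def s_def by (simp add: mult.assoc)
  finally have F: "(\<Sum>j\<le>Suc m. Q j * s (Suc m) j) * K
      = quad_poch (D * w) (C * D) p m * (1 - p ^ m * D * w + p ^ (2 * m) * C * D)
        / (q_poch p p m * q_poch C p m)" by (simp add: mult_ac)
  have "K \<noteq> 0" using p1[of m] C1[of m] by (simp add: K_def)
  from eq_divide_imp[OF this F] show ?case
    unfolding Q_def s_def K_def by (simp only: quad_poch_Suc q_poch_Suc power_Suc mult_ac divide_divide_eq_left)
qed

text \<open>In base q^2 this is the classical Bailey pair relative to a = q with both parameters b =
  c = q, that is, a terminating 6phi5 sum; \<open>q_poch q (q\<^sup>2) (Suc (k + r))\<close> is (a
  q^2; q^2)_(k+r) up to the factor 1 - q. It takes care of the three parameters q that stay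
  unperturbed.\<close>

lemma bailey_pair:
  fixes q :: "'a::field"
  assumes q0: "q \<noteq> 0" and q: "\<And>i. i > 0 \<Longrightarrow> q ^ i \<noteq> 1"
  shows "(\<Sum>r\<le>k. (-1) ^ r * q ^ (r\<^sup>2) * (1 - q ^ (4 * r + 1))
            * (q_poch q (q\<^sup>2) r / q_poch (q\<^sup>2) (q\<^sup>2) r) ^ 3
            / (q_poch (q\<^sup>2) (q\<^sup>2) (k - r) * q_poch q (q\<^sup>2) (Suc (k + r))))
         = q_poch q (q\<^sup>2) k / q_poch (q\<^sup>2) (q\<^sup>2) k ^ 3"
proof (induction k)
  case 0
  show ?case using q[of 1] by (simp add: q_poch_Suc)
next
  case (Suc k)
  have e: "q\<^sup>2 * (q\<^sup>2) ^ i = q ^ (2 * i + 2)" "q * (q\<^sup>2) ^ i = q ^ (2 * i + 1)" for i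
    by (simp_all add: power_mult power_add power2_eq_square)
  have E [simp]: "q_poch (q\<^sup>2) (q\<^sup>2) i \<noteq> 0" for i
    using q by (intro q_poch_nonzero) (simp add: e del: power_Suc)
  have O [simp]: "q_poch q (q\<^sup>2) i \<noteq> 0" for i
    using q by (intro q_poch_nonzero) (simp add: e del: power_Suc)
  have ES: "q_poch (q\<^sup>2) (q\<^sup>2) (Suc i) = q_poch (q\<^sup>2) (q\<^sup>2) i * (1 - q ^ (2 * i + 2))"
    and OS: "q_poch q (q\<^sup>2) (Suc i) = q_poch q (q\<^sup>2) i * (1 - q ^ (2 * i + 1))" for i
    by (simp_all add: q_poch_Suc e del: power_Suc)
  have q1: "1 - q ^ i \<noteq> 0" if "i > 0" for i using q[OF that] by auto
  define t where "t = (\<lambda>r. (-1) ^ r * q ^ (r\<^sup>2) * (q_poch q (q\<^sup>2) r / q_poch (q\<^sup>2) (q\<^sup>2) r) ^ 3)"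
  define T where "T = (\<lambda>k r. (1 - q ^ (4 * r + 1)) * t r
            / (q_poch (q\<^sup>2) (q\<^sup>2) (k - r) * q_poch q (q\<^sup>2) (Suc (k + r))))"
  \<comment> \<open>Wilf--Zeilberger certificate for the recurrence of the sum in \<open>k\<close>\<close>
  define G where "G = (\<lambda>r. - (t r * (1 - q ^ (2 * r)) ^ 3 * q ^ (2 * (Suc k - r)))
            / (q_poch (q\<^sup>2) (q\<^sup>2) (Suc k - r) * q_poch q (q\<^sup>2) (Suc k + r)))"
  have tS: "t (Suc r) * (1 - q ^ (2 * r + 2)) ^ 3 = - (q ^ (2 * r + 1) * (1 - q ^ (2 * r + 1)) ^ 3 * t r)" for r
  proof -
    have "q ^ ((Suc r)\<^sup>2) = q ^ (r\<^sup>2) * q ^ (2 * r + 1)"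
      unfolding power_add[symmetric] by (intro arg_cong[of _ _ "(^) q"]) (simp add: power2_eq_square)
    thus ?thesis using q1[of "2 * r + 2"] unfolding t_def ES OS
      by (simp add: power_divide power_mult_distrib del: power_Suc) simp
  qed
  have step: "(1 - q ^ (2 * k + 2)) ^ 3 * T (Suc k) r - (1 - q ^ (2 * k + 1)) * T k r = G (Suc r) - G r"
    if r: "r \<le> k" for r
  proof -
    obtain l where k: "k = r + l" using r by (auto simp: le_iff_add)
    have ix: "Suc k - Suc r = l" "Suc k - r = Suc l" "k - r = l" "Suc k + Suc r = Suc (Suc (2 * r + l))"
      "Suc k + r = Suc (2 * r + l)" "Suc (k + r) = Suc (2 * r + l)"
      "Suc (Suc k + r) = Suc (Suc (2 * r + l))"
      by (simp_all add: k)
    have "- (t (Suc r) * (1 - q ^ (2 * Suc r)) ^ 3 * q ^ (2 * (Suc k - Suc r)))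
       = q ^ (2 * r + 1) * (1 - q ^ (2 * r + 1)) ^ 3 * t r * q ^ (2 * l)"
      using tS[of r] by (simp add: k)
    hence G1: "G (Suc r) = q ^ (2 * r + 1) * (1 - q ^ (2 * r + 1)) ^ 3 * t r * q ^ (2 * l)
       / (q_poch (q\<^sup>2) (q\<^sup>2) l * (q_poch q (q\<^sup>2) (Suc (2 * r + l)) * (1 - q ^ (2 * Suc (2 * r + l) + 1))))"
      unfolding G_def ix OS[of "Suc (2 * r + l)", symmetric] by simp
    define y where "y = q ^ r"
    define z where "z = q ^ l"
    have nz: "1 - q ^ (2 * l + 2) \<noteq> 0" "1 - q ^ (2 * Suc (2 * r + l) + 1) \<noteq> 0"
      by (intro q1; simp)+
    have GG: "G r = - (t r * (1 - q ^ (2 * r)) ^ 3 * q ^ (2 * l + 2))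
            / (q_poch (q\<^sup>2) (q\<^sup>2) l * (1 - q ^ (2 * l + 2)) * q_poch q (q\<^sup>2) (Suc (2 * r + l)))"
      unfolding G_def ix ES by (simp del: power_Suc)
    have T1: "T (Suc k) r = (1 - q ^ (4 * r + 1)) * t r
            / (q_poch (q\<^sup>2) (q\<^sup>2) l * (1 - q ^ (2 * l + 2)) * (q_poch q (q\<^sup>2) (Suc (2 * r + l)) * (1 - q ^ (2 * Suc (2 * r + l) + 1))))"
      unfolding T_def ix ES OS[of "Suc (2 * r + l)", symmetric] by simp
    have T0: "T k r = (1 - q ^ (4 * r + 1)) * t r
            / (q_poch (q\<^sup>2) (q\<^sup>2) l * q_poch q (q\<^sup>2) (Suc (2 * r + l)))"
      unfolding T_def ix by simp
    have pw: "q ^ (2 * l + 2) = q\<^sup>2 * z\<^sup>2" "q ^ (2 * Suc (2 * r + l) + 1) = q ^ 3 * y ^ 4 * z\<^sup>2"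
      "q ^ (2 * r) = y\<^sup>2" "q ^ (2 * l) = z\<^sup>2" "q ^ (2 * r + 1) = q * y\<^sup>2" "q ^ (4 * r + 1) = q * y ^ 4"
      "q ^ (2 * k + 2) = q\<^sup>2 * y\<^sup>2 * z\<^sup>2" "q ^ (2 * k + 1) = q * y\<^sup>2 * z\<^sup>2"
      by (simp_all add: y_def z_def k power_add power_mult[symmetric] mult.commute power2_eq_square eval_nat_numeral algebra_simps)
    define a where "a = q_poch (q\<^sup>2) (q\<^sup>2) l"
    define b where "b = q_poch q (q\<^sup>2) (Suc (2 * r + l))"
    have ab: "a \<noteq> 0" "b \<noteq> 0" by (simp_all add: a_def b_def)
    show ?thesis
      using nz ab unfolding G1 GG T1 T0 pw a_def[symmetric] b_def[symmetric]
      by (simp add: divide_simps) algebra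
  qed
  have "(1 - q ^ (2 * k + 2)) ^ 3 * (\<Sum>r\<le>Suc k. T (Suc k) r) - (1 - q ^ (2 * k + 1)) * (\<Sum>r\<le>k. T k r)
     = (\<Sum>r\<le>k. G (Suc r) - G r) + (1 - q ^ (2 * k + 2)) ^ 3 * T (Suc k) (Suc k)"
  proof -
    have "(\<Sum>r\<le>k. G (Suc r) - G r)
        = (\<Sum>r\<le>k. (1 - q ^ (2 * k + 2)) ^ 3 * T (Suc k) r - (1 - q ^ (2 * k + 1)) * T k r)"
      by (intro sum.cong refl) (simp only: step atMost_iff)
    thus ?thesis
      unfolding sum_subtractf sum_distrib_left[symmetric] sum.atMost_Suc distrib_left by (simp del: power_Suc)
  qed
  also have "(\<Sum>r\<le>k. G (Suc r) - G r) = G (Suc k) - G 0"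
    using sum_telescope[of "\<lambda>i. - G i" k] by simp
  also have "G 0 = 0" by (simp add: G_def)
  \<comment> \<open>The term r = Suc k of the longer sum lies outside the range of
    \<open>step\<close>, since k - r would be truncated there; the boundary value of the certificate
    cancels it.\<close>
  also have "G (Suc k) - 0 + (1 - q ^ (2 * k + 2)) ^ 3 * T (Suc k) (Suc k) = 0"
  proof -
    have nz: "1 - q ^ (4 * k + 5) \<noteq> 0" by (rule q1) simp
    have ix: "Suc k - Suc k = 0" "Suc k + Suc k = Suc (Suc (2 * k))" "2 * Suc k = 2 * k + 2"
      "4 * Suc k + 1 = 4 * k + 5" "2 * Suc (Suc (2 * k)) + 1 = 4 * k + 5" "2 * 0 = (0::nat)" by simp_all
    have "T (Suc k) (Suc k) = t (Suc k) / q_poch q (q\<^sup>2) (Suc (Suc (2 * k)))"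
      unfolding T_def ix OS[of "Suc (Suc (2 * k))"] using nz by (simp del: power_Suc)
    moreover have "G (Suc k) = - (t (Suc k) * (1 - q ^ (2 * k + 2)) ^ 3) / q_poch q (q\<^sup>2) (Suc (Suc (2 * k)))"
      unfolding G_def ix by simp
    ultimately show ?thesis by (simp add: mult_ac)
  qed
  finally have "(1 - q ^ (2 * k + 2)) ^ 3 * (\<Sum>r\<le>Suc k. T (Suc k) r)
      = (1 - q ^ (2 * k + 1)) * (\<Sum>r\<le>k. T k r)" by simp
  also have "(\<Sum>r\<le>k. T k r) = q_poch q (q\<^sup>2) k / q_poch (q\<^sup>2) (q\<^sup>2) k ^ 3"
    using Suc.IH by (simp add: T_def t_def mult_ac)
  finally have "(\<Sum>r\<le>Suc k. T (Suc k) r) * (1 - q ^ (2 * k + 2)) ^ 3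
      = q_poch q (q\<^sup>2) k * (1 - q ^ (2 * k + 1)) / q_poch (q\<^sup>2) (q\<^sup>2) k ^ 3"
    by (simp only: mult_ac times_divide_eq_right)
  moreover have "(1 - q ^ (2 * k + 2)) ^ 3 \<noteq> 0"
    using q1[of "2 * k + 2"] by (simp del: power_Suc)
  ultimately have "(\<Sum>r\<le>Suc k. T (Suc k) r) = q_poch q (q\<^sup>2) (Suc k) / q_poch (q\<^sup>2) (q\<^sup>2) (Suc k) ^ 3"
    unfolding ES OS power_mult_distrib by (metis eq_divide_imp divide_divide_eq_left)
  thus ?case by (simp add: T_def t_def mult_ac)
qed

lemma sum_triangle:
  fixes f :: "nat \<Rightarrow> nat \<Rightarrow> 'a::comm_monoid_add"
  shows "(\<Sum>r\<le>N. \<Sum>j\<le>N - r. f r (r + j)) = (\<Sum>k\<le>N. \<Sum>r\<le>k. f r k)"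
proof -
  have "(\<Sum>r\<le>N. \<Sum>j\<le>N - r. f r (r + j)) = (\<Sum>(r, j)\<in>(SIGMA r:{..N}. {..N - r}). f r (r + j))"
    by (simp add: sum.Sigma)
  also have "\<dots> = (\<Sum>(k, r)\<in>(SIGMA k:{..N}. {..k}). f r k)"
    by (rule sum.reindex_bij_witness[of _ "\<lambda>(k, r). (r, k - r)" "\<lambda>(r, j). (r + j, r)"]) auto
  finally show ?thesis by (simp add: sum.Sigma)
qed

text \<open>Reversing the order of the factors turns the products with negative exponents into
  products of 1 - 1/e over the same e as in the positive ones, and 1 - 1/e is a unit times 1 - e. It
  brings the prefactor of the transformation into even powers of q, where it can be compared factor
  by factor with \<open>R N\<close>.\<close>

lemma q_poch_reflect:
  fixes q :: "'a::field"
  assumes q0: "q \<noteq> 0"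
  shows "q_poch q (q\<^sup>2) N * q_poch (q / q ^ (2 * N + 1)) (q\<^sup>2) N * q ^ N
       = q_poch (q\<^sup>2) (q\<^sup>2) N * q_poch (q\<^sup>2 / q ^ (2 * N + 1)) (q\<^sup>2) N"
proof -
  have rev: "q_poch y b N = (\<Prod>i<N. 1 - y * b ^ (N - Suc i))" for y b :: 'a
    unfolding q_poch_def by (subst prod.nat_diff_reindex[symmetric]) simp
  have "q_poch q (q\<^sup>2) N * q_poch (q / q ^ (2 * N + 1)) (q\<^sup>2) N * q ^ N
     = (\<Prod>i<N. (1 - q * (q\<^sup>2) ^ i) * (1 - q / q ^ (2 * N + 1) * (q\<^sup>2) ^ (N - Suc i)) * q)"
    unfolding rev[of "q / q ^ (2 * N + 1)"] unfolding q_poch_def prod.distrib by simp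
  also have "\<dots> = (\<Prod>i<N. (1 - q\<^sup>2 * (q\<^sup>2) ^ i) * (1 - q\<^sup>2 / q ^ (2 * N + 1) * (q\<^sup>2) ^ (N - Suc i)))"
  proof (intro prod.cong refl)
    fix i assume "i \<in> {..<N}"
    then obtain l where N: "N = Suc i + l" using less_iff_Suc_add[of i N] by auto
    have [simp]: "N - Suc i = l" by (simp add: N)
    have e: "q ^ (2 * N + 1) = q ^ 3 * (q\<^sup>2) ^ i * (q\<^sup>2) ^ l"
      by (simp add: N power_add power_mult[symmetric] power_mult_distrib eval_nat_numeral algebra_simps)
    have "(q\<^sup>2) ^ l \<noteq> 0" "(q\<^sup>2) ^ i \<noteq> 0" using q0 by simp_all
    then have c: "q / q ^ (2 * N + 1) * (q\<^sup>2) ^ (N - Suc i) = 1 / (q\<^sup>2 * (q\<^sup>2) ^ i)"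
      "q\<^sup>2 / q ^ (2 * N + 1) * (q\<^sup>2) ^ (N - Suc i) = 1 / (q * (q\<^sup>2) ^ i)"
      using q0 unfolding e by (simp_all add: field_simps eval_nat_numeral)
    show "(1 - q * (q\<^sup>2) ^ i) * (1 - q / q ^ (2 * N + 1) * (q\<^sup>2) ^ (N - Suc i)) * q
       = (1 - q\<^sup>2 * (q\<^sup>2) ^ i) * (1 - q\<^sup>2 / q ^ (2 * N + 1) * (q\<^sup>2) ^ (N - Suc i))"
      unfolding c using q0 \<open>(q\<^sup>2) ^ i \<noteq> 0\<close> by (simp add: field_simps power2_eq_square)
  qed
  also have "\<dots> = q_poch (q\<^sup>2) (q\<^sup>2) N * q_poch (q\<^sup>2 / q ^ (2 * N + 1)) (q\<^sup>2) N"
    unfolding rev[of "q\<^sup>2 / q ^ (2 * N + 1)"] unfolding q_poch_def prod.distrib by simp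
  finally show ?thesis .
qed

text \<open>Watson's 8phi7 to 4phi3 transformation in base q^2 with a = b = c = q, proved by
  Bailey's method. The remaining parameters are q^(-2N) = q/x and a pair d, e with d + e = q w and d
  e = q^2 x. The product d e makes the argument of the series q and the last lower parameter d e
  q^(-2N) / a of the 4phi3 equal to q^2; the sum w stays free.\<close>

lemma watson_transformation:
  fixes q w x :: "'a::field" and N :: nat
  defines "x \<equiv> q ^ (2 * N + 1)"
  defines "A \<equiv> q_poch (q / x) (q\<^sup>2)" and "B \<equiv> q_poch (q\<^sup>2 * x) (q\<^sup>2)"
  defines "U \<equiv> q_poch q (q\<^sup>2)" and "E \<equiv> q_poch (q\<^sup>2) (q\<^sup>2)"
  defines "Q \<equiv> quad_poch (q * w) (q\<^sup>2 * x) (q\<^sup>2)" and "R \<equiv> quad_poch (q\<^sup>2 * w / x) (q ^ 4 / x) (q\<^sup>2)"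
  assumes q0: "q \<noteq> 0" and q: "\<And>i. i > 0 \<Longrightarrow> q ^ i \<noteq> 1" and R: "R N \<noteq> 0"
  shows "(\<Sum>r\<le>N. (1 - q ^ (4 * r + 1)) * q ^ r * (U r / E r) ^ 3 * (A r * Q r / (B r * R r)))
    = (1 - x) * (E N * q_poch (q\<^sup>2 / x) (q\<^sup>2) N / R N) / q ^ N
      * (\<Sum>k\<le>N. q ^ (2 * k) * U k * (A k * Q k) / E k ^ 4)"
proof -
  define p where "p = q\<^sup>2"
  define D where "D = q / x"
  have q1: "1 - q ^ i \<noteq> 0" if "i > 0" for i using q[OF that] by auto
  have x0: "x \<noteq> 0" using q0 by (simp add: x_def)
  have pe: "p * p ^ i = q ^ (2 * i + 2)" "q * p ^ i = q ^ (2 * i + 1)" "p ^ i = q ^ (2 * i)" for i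
    by (simp_all add: p_def power_mult power_add power2_eq_square)
  have p0: "p \<noteq> 0" using q0 by (simp add: p_def)
  have DN: "D * p ^ N = 1" using q0 by (simp add: D_def x_def p_def power_mult)
  have Dp: "D * p ^ i \<noteq> 1" if "i < N" for i
  proof
    assume "D * p ^ i = 1"
    hence "p ^ i = p ^ i * p ^ (N - i)" using DN p0 that by (metis le_add_diff_inverse less_imp_le mult_cancel_left mult.commute power_add mult_zero_left zero_neq_one)
    hence "p ^ (N - i) = 1" using p0 by simp
    thus False using q[of "2 * (N - i)"] that pe(3)[of "N - i"] by simp
  qed
  have Bp: "p * x * p ^ i \<noteq> 1" for i
  proof -
    have "p * x * p ^ i = q ^ (2 * N + 1) * (p * p ^ i)" by (simp add: x_def mult_ac)
    also have "\<dots> = q ^ (2 * N + 1 + (2 * i + 2))" by (simp only: pe(1) power_add)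
    also have "\<dots> \<noteq> 1" by (rule q) simp
    finally show ?thesis .
  qed
  have E0 [simp]: "E i \<noteq> 0" for i
    unfolding E_def p_def[symmetric] by (intro q_poch_nonzero) (use q pe in \<open>simp del: power_Suc\<close>)
  have U0 [simp]: "U i \<noteq> 0" for i
    unfolding U_def p_def[symmetric] by (intro q_poch_nonzero) (use q pe in \<open>simp del: power_Suc\<close>)
  have B0 [simp]: "B i \<noteq> 0" for i
    unfolding B_def p_def[symmetric] by (intro q_poch_nonzero Bp)
  have A0: "A i \<noteq> 0" if "i \<le> N" for i
    unfolding A_def p_def[symmetric] D_def[symmetric] by (intro q_poch_nonzero Dp) (use that in simp)
  have ES: "E (Suc i) = E i * (1 - p * p ^ i)" and US: "U (Suc i) = U i * (1 - q * p ^ i)"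
    and AS: "A (Suc i) = A i * (1 - D * p ^ i)" and BS: "B (Suc i) = B i * (1 - p * x * p ^ i)" for i
    by (simp_all add: E_def U_def A_def B_def q_poch_Suc p_def D_def)
  have z0 [simp]: "E 0 = 1" "U 0 = 1" "A 0 = 1" "B 0 = 1" "Q 0 = 1" "R 0 = 1"
    by (simp_all add: E_def U_def A_def B_def Q_def R_def)
  define \<kappa> where "\<kappa> = E N / A N"
  have \<kappa>0: "\<kappa> \<noteq> 0" using A0[of N] by (simp add: \<kappa>_def)
  have Rr: "R r \<noteq> 0" if "r \<le> N" for r
    using R quad_poch_add[of "q\<^sup>2 * w / x" "q ^ 4 / x" "q\<^sup>2" r "N - r"] that by (auto simp: R_def)
  \<comment> \<open>The Saalschuetz sum contains (D; p) with index m - j instead of r + j. Because D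
    p^N = 1, the reversal k to N - k converts one into the other, at the price of the constant
    \<open>\<kappa>\<close>.\<close>
  have flip: "A k * p ^ k / E k = \<kappa> * D ^ k * A (N - k) / E (N - k)" if "k \<le> N" for k
    using that
  proof (induction k)
    case 0
    thus ?case using A0[of N] by (simp add: \<kappa>_def)
  next
    case (Suc k)
    then obtain l where N: "N = Suc k + l" by (auto simp: le_iff_add)
    have [simp]: "N - k = Suc l" "N - Suc k = l" by (simp_all add: N)
    have IH: "A k * p ^ k / E k = \<kappa> * D ^ k * A (Suc l) / E (Suc l)"
      using Suc by simp
    have a: "1 - D * p ^ l \<noteq> 0" using Dp[of l] by (auto simp: N)
    have b: "1 - p * p ^ l \<noteq> 0" "1 - p * p ^ k \<noteq> 0" unfolding pe(1) by (intro q1; simp)+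
    define y z where "y = p ^ k" and "z = p ^ l"
    have D1: "D * (p * y * z) = 1" using DN by (simp add: N y_def z_def power_add mult_ac)
    have nn: "y \<noteq> 0" "z \<noteq> 0" using p0 by (simp_all add: y_def z_def)
    have key: "p * (1 - D * y) * (1 - D * z) = D * (1 - p * z) * (1 - p * y)"
      using D1 by algebra
    have "A (Suc k) * p ^ Suc k / E (Suc k) = A k * p ^ k / E k * (p * (1 - D * y) / (1 - p * y))"
      by (simp add: AS ES y_def)
    also have "\<dots> = \<kappa> * D ^ k * A l / E l * ((1 - D * z) / (1 - p * z) * (p * (1 - D * y) / (1 - p * y)))"
      unfolding IH AS ES z_def by (simp add: mult_ac)
    also have "(1 - D * z) / (1 - p * z) * (p * (1 - D * y) / (1 - p * y)) = D"
      using key b unfolding y_def[symmetric] z_def[symmetric] by (simp add: divide_simps) (simp add: mult_ac)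
    finally show ?case by (simp add: mult_ac)
  qed
  \<comment> \<open>The same relation D p^N = 1 extracts the sign and the square exponent of the
    Bailey pair, together with the kernel 1 / (E (N - r) U (N + r + 1)).\<close>
  have bal: "q ^ r * A r / B r = (-1) ^ r * q ^ (r\<^sup>2) * D ^ r * (E N * U (Suc N)) / (E (N - r) * U (Suc (N + r)))"
    if "r \<le> N" for r
    using that
  proof (induction r)
    case 0
    thus ?case by simp
  next
    case (Suc r)
    then obtain l where N: "N = Suc r + l" by (auto simp: le_iff_add)
    have [simp]: "N - r = Suc l" "N - Suc r = l" by (simp_all add: N)
    have IH: "q ^ r * A r / B r = (-1) ^ r * q ^ (r\<^sup>2) * D ^ r * (E N * U (Suc N)) / (E (Suc l) * U (Suc (N + r)))"
      using Suc by simp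
    define y z where "y = p ^ r" and "z = p ^ l"
    have D1: "D * (p * y * z) = 1" using DN by (simp add: N y_def z_def power_add mult_ac)
    have b: "1 - p * z \<noteq> 0" unfolding z_def pe(1) by (intro q1; simp)
    have "x = q * p ^ N" by (simp add: x_def p_def power_mult)
    hence xx: "x = q * p * y * z"
      by (simp add: y_def z_def N power_add mult_ac)
    have bb: "1 - p * x * y \<noteq> 0" using Bp[of r] by (auto simp: y_def)
    have UU: "U (Suc (N + Suc r)) = U (Suc (N + r)) * (1 - p * x * y)"
    proof -
      have "q * p ^ Suc (N + r) = p * x * y"
        by (simp add: xx y_def z_def N power_add mult_ac)
      thus ?thesis using US[of "Suc (N + r)"] by simp
    qed
    have key: "q * (1 - D * y) = - (q * y) * D * (1 - p * z)"
      using D1 by algebra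
    have "q ^ Suc r * A (Suc r) / B (Suc r) = q ^ r * A r / B r * (q * (1 - D * y) / (1 - p * x * y))"
      by (simp add: AS BS y_def)
    also have "\<dots> = (-1) ^ r * q ^ (r\<^sup>2) * D ^ r * (E N * U (Suc N)) / (E l * U (Suc (N + r)))
        * (1 / (1 - p * z)) * (q * (1 - D * y) / (1 - p * x * y))"
      unfolding IH ES z_def by (simp add: mult_ac)
    also have "\<dots> = (-1) ^ Suc r * (q ^ (r\<^sup>2) * (q * y)) * D ^ Suc r * (E N * U (Suc N)) / (E l * U (Suc (N + Suc r)))"
      unfolding key UU using b by (simp add: mult_ac)
    also have "q ^ (r\<^sup>2) * (q * y) = q ^ ((Suc r)\<^sup>2)"
      unfolding y_def pe(2) power_add[symmetric] by (intro arg_cong[of _ _ "(^) q"]) (simp add: power2_eq_square)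
    finally show ?case by simp
  qed
  \<comment> \<open>\<open>\<delta>\<close> and the sums in \<open>gam\<close> form the conjugate
    Bailey pair. After the index shift by r the sum is Saalschuetzian with C = q p^(2r+1).\<close>
  define \<delta> where "\<delta> = (\<lambda>k. A k * p ^ k * Q k / E k)"
  have gam: "(\<Sum>j\<le>N - r. \<delta> (r + j) / (E j * U (Suc (r + j + r))))
       = \<kappa> * D ^ r * Q r * (R N / R r) / (E (N - r) * U (Suc (N + r)))" if r: "r \<le> N" for r
  proof -
    define m where "m = N - r"
    have N: "N = r + m" using r by (simp add: m_def)
    define C where "C = q ^ (4 * r + 3)"
    define w' where "w' = q * w * p ^ r"
    define c' where "c' = p * x * p ^ (2 * r)"
    have DC: "D * c' = C"
      using x0 by (simp add: D_def c'_def C_def p_def power_mult_distrib power_add eval_nat_numeral mult_ac)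
    have Uadd: "U (Suc (2 * r) + j) = U (Suc (2 * r)) * q_poch C p j" for j
    proof -
      have "q * p ^ Suc (2 * r) = C"
        by (simp add: C_def p_def power_mult_distrib power_add eval_nat_numeral mult_ac)
      thus ?thesis unfolding U_def p_def[symmetric] q_poch_add by simp
    qed
    have Qadd: "Q (r + j) = Q r * quad_poch w' c' p j" for j
      unfolding Q_def p_def[symmetric] quad_poch_add w'_def c'_def by simp
    have Radd: "R N = R r * quad_poch (D * w') (C * D) p m"
    proof -
      have "p * w / x * p ^ r = D * w'" 
        by (simp add: D_def w'_def p_def power2_eq_square)
      moreover have "q ^ 4 / x * p ^ (2 * r) = C * D"
        by (simp add: D_def C_def p_def power_mult_distrib power_add eval_nat_numeral mult_ac)
      ultimately show ?thesis
        unfolding R_def p_def[symmetric] N quad_poch_add by simp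
    qed
    have "\<delta> (r + j) / (E j * U (Suc (r + j + r)))
       = \<kappa> * D ^ r * Q r / U (Suc (2 * r)) *
          (quad_poch w' c' p j * (D ^ j * q_poch D p (m - j) / (E j * q_poch C p j * E (m - j))))"
      if "j \<le> m" for j
    proof -
      have "\<delta> (r + j) = A (r + j) * p ^ (r + j) / E (r + j) * Q (r + j)" by (simp add: \<delta>_def)
      also have "A (r + j) * p ^ (r + j) / E (r + j) = \<kappa> * D ^ (r + j) * A (m - j) / E (m - j)"
        using flip[of "r + j"] that by (simp add: N)
      moreover have "Suc (r + j + r) = Suc (2 * r) + j" by simp
      ultimately show ?thesis
        unfolding Qadd by (simp only: Uadd) (simp add: A_def p_def D_def power_add mult_ac)
    qed
    hence "(\<Sum>j\<le>m. \<delta> (r + j) / (E j * U (Suc (r + j + r))))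
       = \<kappa> * D ^ r * Q r / U (Suc (2 * r)) *
          (\<Sum>j\<le>m. quad_poch w' c' p j * (D ^ j * q_poch D p (m - j) / (E j * q_poch C p j * E (m - j))))"
      unfolding sum_distrib_left by (intro sum.cong) auto
    also have "(\<Sum>j\<le>m. quad_poch w' c' p j * (D ^ j * q_poch D p (m - j) / (E j * q_poch C p j * E (m - j))))
        = quad_poch (D * w') (C * D) p m / (E m * q_poch C p m)"
      unfolding E_def p_def[symmetric]
    proof (rule q_saalschuetz[OF DC])
      show "p ^ i \<noteq> 1" if "i > 0" for i using q[of "2 * i"] that by (simp add: pe(3))
      show "C * p ^ i \<noteq> 1" for i using q[of "4 * r + 3 + 2 * i"] by (simp add: pe(3) C_def power_add mult_ac)
    qed
    finally have "(\<Sum>j\<le>m. \<delta> (r + j) / (E j * U (Suc (r + j + r))))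
        = \<kappa> * D ^ r * Q r * quad_poch (D * w') (C * D) p m / (E m * (U (Suc (2 * r)) * q_poch C p m))"
      by (simp add: mult_ac)
    moreover have "U (Suc (2 * r)) * q_poch C p m = U (Suc (N + r))"
      unfolding Uadd[symmetric] by (intro arg_cong[of _ _ U]) (simp add: N)
    ultimately show ?thesis
      using Rr[OF r] unfolding m_def[symmetric] Radd by simp
  qed
  define \<alpha> where "\<alpha> = (\<lambda>r. (-1) ^ r * q ^ (r\<^sup>2) * (1 - q ^ (4 * r + 1)) * (U r / E r) ^ 3)"
  have "(\<Sum>r\<le>N. (1 - q ^ (4 * r + 1)) * q ^ r * (U r / E r) ^ 3 * (A r * Q r / (B r * R r)))
     = (\<Sum>r\<le>N. E N * U (Suc N) / (\<kappa> * R N) * (\<alpha> r * (\<Sum>j\<le>N - r. \<delta> (r + j) / (E j * U (Suc (r + j + r))))))"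
  proof (intro sum.cong refl)
    fix r assume "r \<in> {..N}"
    hence r: "r \<le> N" by simp
    have "(1 - q ^ (4 * r + 1)) * q ^ r * (U r / E r) ^ 3 * (A r * Q r / (B r * R r))
      = (1 - q ^ (4 * r + 1)) * (U r / E r) ^ 3 * Q r / R r * (q ^ r * A r / B r)"
      by (simp add: mult_ac)
    also have "\<dots> = E N * U (Suc N) / (\<kappa> * R N) * (\<alpha> r * (\<Sum>j\<le>N - r. \<delta> (r + j) / (E j * U (Suc (r + j + r)))))"
      unfolding bal[OF r] gam[OF r] using \<kappa>0 R by (simp add: \<alpha>_def)
    finally show "(1 - q ^ (4 * r + 1)) * q ^ r * (U r / E r) ^ 3 * (A r * Q r / (B r * R r)) = \<dots>" .
  qed
  also have "\<dots> = E N * U (Suc N) / (\<kappa> * R N) *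
      (\<Sum>r\<le>N. \<Sum>j\<le>N - r. \<alpha> r * \<delta> (r + j) / (E (r + j - r) * U (Suc (r + j + r))))"
    by (simp add: sum_distrib_left)
  \<comment> \<open>Exchanging the order of summation leaves an inner sum over r, which is the
    Bailey pair.\<close>
  also have "(\<Sum>r\<le>N. \<Sum>j\<le>N - r. \<alpha> r * \<delta> (r + j) / (E (r + j - r) * U (Suc (r + j + r))))
      = (\<Sum>k\<le>N. \<Sum>r\<le>k. \<alpha> r * \<delta> k / (E (k - r) * U (Suc (k + r))))"
    by (rule sum_triangle)
  also have "\<dots> = (\<Sum>k\<le>N. \<delta> k * (\<Sum>r\<le>k. \<alpha> r / (E (k - r) * U (Suc (k + r)))))"
    by (simp add: sum_distrib_left mult_ac)
  also have "\<dots> = (\<Sum>k\<le>N. \<delta> k * (U k / E k ^ 3))"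
    using bailey_pair[OF q0 q] by (simp add: \<alpha>_def E_def U_def)
  also have "\<dots> = (\<Sum>k\<le>N. q ^ (2 * k) * U k * (A k * Q k) / E k ^ 4)"
    by (intro sum.cong refl) (simp add: \<delta>_def pe eval_nat_numeral mult_ac)
  also have "E N * U (Suc N) / (\<kappa> * R N) = (1 - x) * (U N * A N) / R N"
    using A0[of N] by (simp add: \<kappa>_def US pe x_def)
  also have "U N * A N = E N * q_poch (q\<^sup>2 / x) (q\<^sup>2) N / q ^ N"
    using q_poch_reflect[OF q0, of N] q0 by (simp add: U_def A_def E_def x_def field_simps)
  finally show ?thesis by (simp add: mult_ac)
qed

subsection \<open>Sums over powers of a root of unity\<close>

text \<open>Summation by parts; at a root of unity w other than 1 the last sum vanishes, which
  yields n / (w - 1).\<close>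

lemma sum_mult_power:
  fixes w :: "'a::comm_ring_1"
  shows "(w - 1) * (\<Sum>k<n. of_nat k * w ^ k) = of_nat n * w ^ n - (\<Sum>k<n. w ^ Suc k)"
  by (induction n) (simp_all add: algebra_simps)

lemma sum_power_unity_root:
  fixes w :: "'a::field"
  assumes "w ^ n = 1" "w \<noteq> 1"
  shows "(\<Sum>k<n. w ^ k) = 0"
  using assms by (simp add: sum_gp_strict)

text \<open>
  Since \<open>1 / (w - 1)\<close> is \<open>1 / n\<close> times the sum of \<open>k * w ^ k\<close> over \<open>k < n\<close>, this is Parseval's identity for
  the sequence \<open>0, 1, \<dots>, n - 1\<close>.
\<close>
lemma sum_unity_root_kernel:
  fixes z :: complex
  assumes n: "n > 0" and z: "z ^ n = 1" and prim: "\<And>j. 0 < j \<Longrightarrow> j < n \<Longrightarrow> z ^ j \<noteq> 1"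
  shows "(\<Sum>j\<in>{1..<n}. z ^ j / (1 - z ^ j)\<^sup>2) = - ((of_nat n)\<^sup>2 - 1) / 12"
proof -
  have z0: "z \<noteq> 0" using z n by (metis power_0_left not_gr_zero zero_neq_one)
  \<comment> \<open>As z lies on the unit circle, \<open>u\<close> is its conjugate, and
    \<open>s\<close> is the discrete Fourier transform of 0, ..., n - 1.\<close>
  define u where "u = inverse z"
  have u: "u ^ n = 1" by (simp add: u_def z power_inverse)
  define s :: "complex \<Rightarrow> complex" where "s = (\<lambda>w. \<Sum>k<n. of_nat k * w ^ k)"
  have s_root: "s w = of_nat n / (w - 1)" if "w ^ n = 1" "w \<noteq> 1" for w
  proof -
    have "(w - 1) * s w = of_nat n"
      unfolding s_def sum_mult_power using that
      by (simp add: sum_distrib_left[symmetric] sum_power_unity_root)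
    thus ?thesis using that by (simp add: field_simps)
  qed
  have kern: "z ^ j / (1 - z ^ j)\<^sup>2 = - s (z ^ j) * s (u ^ j) / (of_nat n)\<^sup>2" if "j \<in> {1..<n}" for j
  proof -
    define w where "w = z ^ j"
    have w1: "w \<noteq> 1" using prim[of j] that by (simp add: w_def)
    have w0: "w \<noteq> 0" using z0 by (simp add: w_def)
    have wn: "w ^ n = 1" "inverse w ^ n = 1"
      by (simp_all add: w_def power_mult[symmetric] mult.commute[of j] power_inverse) (simp_all add: power_mult z)
    have uw: "u ^ j = inverse w" by (simp add: u_def w_def power_inverse)
    have "s w * s (inverse w) = of_nat n / (w - 1) * (of_nat n / (inverse w - 1))"
      using s_root[OF wn(1) w1] s_root[OF wn(2)] w1 by simp
    also have "\<dots> = - (of_nat n)\<^sup>2 * (w / (1 - w)\<^sup>2)"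
      using w0 w1 by (simp add: divide_simps power2_eq_square) algebra
    finally show ?thesis using n unfolding w_def[symmetric] uw by simp
  qed
  have orth: "(\<Sum>j<n. (z ^ k * u ^ l) ^ j) = (if k = l then of_nat n else 0)" if "k < n" "l < n" for k l
  proof (cases "k = l")
    case True
    have "z ^ k * u ^ k = 1" using z0 by (simp add: u_def power_mult_distrib[symmetric])
    thus ?thesis using True by simp
  next
    case False
    have "z ^ k * u ^ l \<noteq> 1"
    proof
      assume "z ^ k * u ^ l = 1"
      hence e: "z ^ k = z ^ l" using z0 by (simp add: u_def power_inverse field_simps)
      have "z ^ (k - l) = 1" if "l < k" using e that z0 by (simp add: power_diff)
      moreover have "z ^ (l - k) = 1" if "k < l" using e that z0 by (simp add: power_diff)
      ultimately show False
        using prim[of "k - l"] prim[of "l - k"] False \<open>k < n\<close> \<open>l < n\<close>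
        by (metis less_imp_diff_less linorder_neqE_nat zero_less_diff)
    qed
    moreover have "(z ^ k * u ^ l) ^ n = 1"
      using z u by (simp add: power_mult_distrib power_mult[symmetric] mult.commute[of _ n]) (simp add: power_mult)
    ultimately show ?thesis using False sum_power_unity_root by simp
  qed
  have "(\<Sum>j<n. s (z ^ j) * s (u ^ j))
     = (\<Sum>j<n. \<Sum>k<n. \<Sum>l<n. of_nat k * of_nat l * (z ^ k * u ^ l) ^ j)"
    unfolding s_def sum_product
    by (intro sum.cong refl) (simp add: power_mult_distrib power_mult[symmetric] mult_ac)
  also have "\<dots> = (\<Sum>k<n. \<Sum>j<n. \<Sum>l<n. of_nat k * of_nat l * (z ^ k * u ^ l) ^ j)"
    by (rule sum.swap)
  also have "\<dots> = (\<Sum>k<n. \<Sum>l<n. of_nat k * of_nat l * (\<Sum>j<n. (z ^ k * u ^ l) ^ j))"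
    unfolding sum_distrib_left by (intro sum.cong refl sum.swap)
  also have "\<dots> = (\<Sum>k<n. \<Sum>l<n. if l = k then of_nat k * of_nat k * of_nat n else 0)"
    by (intro sum.cong refl) (simp add: orth)
  also have "\<dots> = of_nat n * (\<Sum>k<n. (of_nat k)\<^sup>2)"
    by (simp add: sum_distrib_left power2_eq_square mult_ac)
  finally have S: "(\<Sum>j<n. s (z ^ j) * s (u ^ j)) = of_nat n * (\<Sum>k<n. (of_nat k)\<^sup>2)" .
  have squares: "(\<Sum>k<m. (of_nat k)\<^sup>2) = (of_nat m * (of_nat m - 1) * (2 * of_nat m - 1) / 6 :: complex)" for m
    by (induction m) (simp_all add: field_simps power2_eq_square)
  have gauss: "(\<Sum>k<m. of_nat k) = (of_nat m * (of_nat m - 1) / 2 :: complex)" for m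
    by (induction m) (simp_all add: field_simps)
  \<comment> \<open>Frequency 0 contributes \<open>s 1\<close> squared but has no term in the kernel
    sum. What is left after removing it is the variance of 0, ..., n - 1, which is (n^2 -
    1)/12.\<close>
  have "{..<n} = insert 0 {1..<n}" using n by auto
  hence "(\<Sum>j<n. s (z ^ j) * s (u ^ j)) = s 1 * s 1 + (\<Sum>j\<in>{1..<n}. s (z ^ j) * s (u ^ j))"
    by simp
  moreover have "(\<Sum>j\<in>{1..<n}. z ^ j / (1 - z ^ j)\<^sup>2) = - (\<Sum>j\<in>{1..<n}. s (z ^ j) * s (u ^ j)) / (of_nat n)\<^sup>2"
    unfolding sum_negf[symmetric] sum_divide_distrib using kern by (intro sum.cong refl) simp
  ultimately have "(\<Sum>j\<in>{1..<n}. z ^ j / (1 - z ^ j)\<^sup>2)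
      = - (of_nat n * (\<Sum>k<n. (of_nat k)\<^sup>2) - s 1 * s 1) / (of_nat n)\<^sup>2"
    using S by simp
  also have "s 1 = of_nat n * (of_nat n - 1) / 2" by (simp add: s_def gauss)
  finally have "(\<Sum>j\<in>{1..<n}. z ^ j / (1 - z ^ j)\<^sup>2)
      = - (of_nat n * (of_nat n * (of_nat n - 1) * (2 * of_nat n - 1) / 6)
          - of_nat n * (of_nat n - 1) / 2 * (of_nat n * (of_nat n - 1) / 2)) / (of_nat n)\<^sup>2"
    unfolding squares .
  moreover have "- (m * (m * (m - 1) * (2 * m - 1) / 6) - m * (m - 1) / 2 * (m * (m - 1) / 2)) / m\<^sup>2
      = - (m\<^sup>2 - 1) / 12" if "m \<noteq> 0" for m :: complex
    using that by (simp add: divide_simps) algebra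
  ultimately show ?thesis using n by simp
qed

section \<open>Roots of unity of odd order\<close>

lemma sum_lessThan_double:
  fixes f :: "nat \<Rightarrow> 'a::comm_monoid_add"
  shows "(\<Sum>j<2 * N. f j) = (\<Sum>i<N. f (2 * i)) + (\<Sum>i<N. f (2 * i + 1))"
  by (induction N) (simp_all add: add_ac)

text \<open>Here 2N+1 is the order of z. The locale serves all roots z of [n], so this order may be
  a proper divisor of n.\<close>

locale odd_unity_root =
  fixes z :: complex and N :: nat
  assumes z: "z ^ (2 * N + 1) = 1" and prim: "\<And>j. 0 < j \<Longrightarrow> j < 2 * N + 1 \<Longrightarrow> z ^ j \<noteq> 1"
begin

lemma root_nonzero: "z \<noteq> 0"
  using z by auto

lemma opposite_power:
  assumes "i + j = 2 * N + 1"
  shows "z ^ i = 1 / z ^ j"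
  using z root_nonzero unfolding assms[symmetric] by (simp add: power_add field_simps)

lemma power_mod_order: "z ^ (l * (2 * N + 1) + j) = z ^ j"
proof -
  have "z ^ (l * (2 * N + 1)) = 1" using z by (metis mult.commute power_mult power_one)
  thus ?thesis by (simp only: power_add[of z "l * (2 * N + 1)"] mult_1_left)
qed

text \<open>The order is odd, so its first positive even multiple is 4N+2, beyond the exponents
  allowed here. Hence the denominators of a block of 2N+1 factors are nonzero up to the last
  one.\<close>

lemma even_power_neq_1:
  assumes "i < 2 * N"
  shows "z ^ (2 * i + 2) \<noteq> 1"
proof (cases "2 * i + 2 < 2 * N + 1")
  case True
  thus ?thesis using prim[of "2 * i + 2"] by simp
next
  case False
  define j where "j = 2 * i + 2 - (2 * N + 1)"
  have j: "2 * i + 2 = 1 * (2 * N + 1) + j" using False by (simp add: j_def)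
  have "0 < j" "j < 2 * N + 1" using False assms unfolding j_def by presburger+
  thus ?thesis unfolding j power_mod_order using prim by simp
qed

text \<open>The kernel is invariant under j to 2N+1-j, which exchanges even and odd j. The even
  exponents thus carry half of the full sum, which turns 12 into 24.\<close>

lemma sum_unity_root_kernel_even:
  "(\<Sum>i<N. z ^ (2 * i + 2) / (1 - z ^ (2 * i + 2))\<^sup>2) = - ((of_nat (2 * N + 1))\<^sup>2 - 1) / 24"
proof -
  define f where "f = (\<lambda>j. z ^ j / (1 - z ^ j)\<^sup>2)"
  have opp: "f i = f j" if "i + j = 2 * N + 1" for i j
  proof (cases "z ^ j = 1")
    case False
    thus ?thesis unfolding f_def opposite_power[OF that] using root_nonzero
      by (simp add: field_simps power2_eq_square)
  qed (simp add: f_def opposite_power[OF that])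
  have "(\<Sum>j\<in>{1..<2 * N + 1}. f j) = (\<Sum>j<2 * N. f (Suc j))"
    by (rule sum.reindex_bij_witness[of _ Suc "\<lambda>j. j - 1"]) auto
  also have "\<dots> = (\<Sum>i<N. f (2 * i + 1)) + (\<Sum>i<N. f (2 * i + 2))"
    by (simp add: sum_lessThan_double)
  also have "(\<Sum>i<N. f (2 * i + 1)) = (\<Sum>i<N. f (2 * (N - Suc i) + 1))"
    by (rule sum.nat_diff_reindex[symmetric])
  also have "\<dots> = (\<Sum>i<N. f (2 * i + 2))"
    by (intro sum.cong refl opp) auto
  finally have "2 * (\<Sum>i<N. f (2 * i + 2)) = (\<Sum>j\<in>{1..<2 * N + 1}. f j)" by simp
  also have "\<dots> = - ((of_nat (2 * N + 1))\<^sup>2 - 1) / 12"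
    unfolding f_def by (rule sum_unity_root_kernel) (use z prim in auto)
  finally have "2 * (\<Sum>i<N. f (2 * i + 2)) = - ((of_nat (2 * N + 1))\<^sup>2 - 1) / 12" .
  moreover have "a = - b / 24" if "2 * a = - b / 12" for a b :: complex
    using that by (simp add: field_simps)
  ultimately show ?thesis unfolding f_def by blast
qed

section \<open>Reflection of the summands about N/2\<close>

definition \<tau> :: "nat \<Rightarrow> complex" where
  "\<tau> r = (\<Prod>i<r. (1 - z ^ (2 * i + 1)) / (1 - z ^ (2 * i + 2)))"

text \<open>The value at z of the coefficient of g in the perturbed summand relative to the original
  one: a factor (1-c)^3 + c g in the numerator contributes c/(1-c)^3, and (1-c)^3 - c^2 g in the
  denominator contributes c^2/(1-c)^3.\<close>

definition lin_coeff :: "nat \<Rightarrow> complex" where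
  "lin_coeff r = (\<Sum>i<r. z ^ (2 * i + 1) / (1 - z ^ (2 * i + 1)) ^ 3 + (z ^ (2 * i + 2))\<^sup>2 / (1 - z ^ (2 * i + 2)) ^ 3)"

text \<open>Exponents i and 2N+1-i have opposite parity and inverse powers of z. So the even product
  of length r is, up to a unit, the top part of the odd product of length N, and both sides equal U
  r U s / U N, which is symmetric in r and s.\<close>

lemma \<tau>_reflect:
  assumes "r + s = N"
  shows "\<tau> r * ((-1) ^ r * z ^ (r * (r + 1))) = \<tau> s * ((-1) ^ s * z ^ (s * (s + 1)))"
proof -
  define U E where "U = (\<lambda>r. \<Prod>i<r. 1 - z ^ (2 * i + 1))" and "E = (\<lambda>r. \<Prod>i<r. 1 - z ^ (2 * i + 2))"
  have ne: "1 - z ^ j \<noteq> 0" if "0 < j" "j < 2 * N + 1" for j using prim[OF that] by simp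
  have E0: "E r \<noteq> 0" if "r \<le> N" for r
    unfolding E_def using that ne by (auto simp del: power_Suc)
  have U0: "U N \<noteq> 0"
    unfolding U_def using ne by (auto simp del: power_Suc)
  have flip: "E r * U (N - r) = (-1) ^ r * z ^ (r * (r + 1)) * U N" if "r \<le> N" for r
    using that
  proof (induction r)
    case (Suc r)
    have d: "N - r = Suc (N - Suc r)" using Suc.prems by simp
    have "z ^ (2 * (N - Suc r) + 1) = 1 / z ^ (2 * r + 2)"
      by (rule opposite_power) (use Suc.prems in simp)
    hence "U (N - r) = U (N - Suc r) * (1 - 1 / z ^ (2 * r + 2))"
      unfolding d U_def by (simp only: prod.lessThan_Suc)
    moreover have "E (Suc r) = E r * (1 - z ^ (2 * r + 2))" by (simp add: E_def)
    moreover have "z ^ (2 * r + 2) \<noteq> 0" using root_nonzero by simp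
    moreover have "a * (1 - e) * b = - e * (a * (b * (1 - 1 / e)))" if "e \<noteq> 0" for a b e :: complex
      using that by (simp add: field_simps)
    ultimately have "E (Suc r) * U (N - Suc r) = - (z ^ (2 * r + 2)) * (E r * U (N - r))"
      by (simp only:)
    also have "\<dots> = (-1) ^ Suc r * (z ^ (r * (r + 1)) * z ^ (2 * r + 2)) * U N"
      using Suc by simp
    also have "z ^ (r * (r + 1)) * z ^ (2 * r + 2) = z ^ (Suc r * (Suc r + 1))"
      unfolding power_add[symmetric] by (intro arg_cong[of _ _ "(^) z"]) simp
    finally show ?case .
  qed (simp add: E_def)
  have tau: "\<tau> r * ((-1) ^ r * z ^ (r * (r + 1))) = U r * U (N - r) / U N" if "r \<le> N" for r
  proof -
    have "\<tau> r = U r / E r" by (simp add: \<tau>_def U_def E_def prod_dividef)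
    moreover have "(-1) ^ r * z ^ (r * (r + 1)) = E r * U (N - r) / U N"
      using flip[OF that] U0 by (simp add: field_simps)
    ultimately show ?thesis using E0[OF that] by simp
  qed
  have "N - r = s" "N - s = r" using assms by auto
  thus ?thesis using tau[of r] tau[of s] assms by (simp add: mult.commute)
qed

text \<open>Under i to N-1-i the odd and even parts of a term are exchanged with a change of sign.
  Dropping the last r terms therefore amounts to adding the first r, and the full sum is
  zero.\<close>

lemma lin_coeff_reflect:
  assumes "r \<le> N"
  shows "lin_coeff (N - r) = lin_coeff r"
proof -
  define f where "f = (\<lambda>i. z ^ (2 * i + 1) / (1 - z ^ (2 * i + 1)) ^ 3 + (z ^ (2 * i + 2))\<^sup>2 / (1 - z ^ (2 * i + 2)) ^ 3)"
  have opp: "f (N - Suc i) = - f i" if "i < N" for i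
  proof -
    define c d where "c = z ^ (2 * i + 1)" and "d = z ^ (2 * i + 2)"
    have nz: "c \<noteq> 0" "d \<noteq> 0" "c \<noteq> 1" "d \<noteq> 1"
      using root_nonzero prim[of "2 * i + 1"] prim[of "2 * i + 2"] that by (simp_all add: c_def d_def)
    have "z ^ (2 * (N - Suc i) + 1) = 1 / d" "z ^ (2 * (N - Suc i) + 2) = 1 / c"
      unfolding c_def d_def by (rule opposite_power; use that in simp)+
    hence "f (N - Suc i) = (1 / d) / (1 - 1 / d) ^ 3 + (1 / c)\<^sup>2 / (1 - 1 / c) ^ 3"
      by (simp only: f_def)
    also have "(1 / d) / (1 - 1 / d) ^ 3 = - (d\<^sup>2 / (1 - d) ^ 3)"
      using nz by (simp add: divide_simps) algebra
    also have "(1 / c)\<^sup>2 / (1 - 1 / c) ^ 3 = - (c / (1 - c) ^ 3)"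
      using nz by (simp add: divide_simps) algebra
    finally show ?thesis by (simp add: f_def c_def d_def)
  qed
  have *: "lin_coeff (N - r) = lin_coeff N + lin_coeff r" if "r \<le> N" for r
    using that
  proof (induction r)
    case (Suc r)
    have d: "N - r = Suc (N - Suc r)" using Suc.prems by simp
    have "lin_coeff (N - r) = lin_coeff (N - Suc r) + f (N - Suc r)" unfolding d lin_coeff_def f_def by simp
    moreover have "lin_coeff (Suc r) = lin_coeff r + f r" unfolding lin_coeff_def f_def by simp
    ultimately show ?case using Suc opp[of r] by (simp add: eq_diff_eq add_ac)
  qed (simp add: lin_coeff_def)
  from *[of N] have "lin_coeff N = 0" by (simp add: lin_coeff_def)
  thus ?thesis using *[OF assms] by simp
qed

text \<open>The value at z of the left-hand summand, multiplied by 1 - q.\<close>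

definition root_summand :: "nat \<Rightarrow> complex" where
  "root_summand r = (1 - z ^ (4 * r + 1)) * z ^ r * \<tau> r ^ 6"

text \<open>The sixth power removes the sign in \<open>\<tau>_reflect\<close>, and modulo the order
  of z the exponents there reduce so that \<tau>(r)^6 z^(3r) is symmetric. The remaining factor
  z^(-2r) - z^(2r+1) equals z^(2s+1) - z^(2r+1) and is antisymmetric.\<close>

lemma root_summand_reflect:
  assumes rs: "r + s = N"
  shows "root_summand s = - root_summand r"
proof -
  have z0: "z \<noteq> 0" by (rule root_nonzero)
  have "(\<tau> r * ((-1) ^ r * z ^ (r * (r + 1)))) ^ 6 = (\<tau> s * ((-1) ^ s * z ^ (s * (s + 1)))) ^ 6"
    by (simp only: \<tau>_reflect[OF rs])
  hence t: "\<tau> r ^ 6 * (z ^ (2 * (r * (r + 1)))) ^ 3 = \<tau> s ^ 6 * (z ^ (2 * (s * (s + 1)))) ^ 3"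
    by (simp add: power_mult_distrib power_mult[symmetric] mult_ac)
  have ex: "z ^ (2 * (r * (r + 1))) * z ^ s * z ^ (2 * r * s) = z ^ (r + s)" if "r + s = N" for r s
  proof -
    have "z ^ (2 * (r * (r + 1))) * z ^ s * z ^ (2 * r * s) = z ^ ((2 * N + 1) * r + (r + s))"
      unfolding power_add[symmetric] that[symmetric] by (intro arg_cong[of _ _ "(^) z"]) (simp add: algebra_simps)
    also have "\<dots> = z ^ (r + s)"
      using z by (simp only: power_add[of z "(2 * N + 1) * r"] power_mult[of z "2 * N + 1"]) simp
    finally show ?thesis .
  qed
  have "z ^ (2 * (s * (s + 1))) * z ^ r * z ^ (2 * r * s) = z ^ (r + s)"
    using ex[of s r] rs by (simp only: mult.assoc mult.commute[of s r] add.commute[of s r])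
  hence "z ^ (2 * (r * (r + 1))) * z ^ s = z ^ (2 * (s * (s + 1))) * z ^ r"
    using ex[OF rs] z0 by (metis mult_right_cancel power_not_zero)
  hence ex2: "(z ^ (2 * (r * (r + 1)))) ^ 3 * (z ^ s) ^ 3 = (z ^ (2 * (s * (s + 1)))) ^ 3 * (z ^ r) ^ 3"
    by (metis power_mult_distrib)
  have t2: "\<tau> r ^ 6 * (z ^ r) ^ 3 = \<tau> s ^ 6 * (z ^ s) ^ 3"
  proof -
    have "(\<tau> r ^ 6 * (z ^ r) ^ 3) * ((z ^ (2 * (r * (r + 1)))) ^ 3 * (z ^ (2 * (s * (s + 1)))) ^ 3)
       = (\<tau> s ^ 6 * (z ^ s) ^ 3) * ((z ^ (2 * (r * (r + 1)))) ^ 3 * (z ^ (2 * (s * (s + 1)))) ^ 3)"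
    proof -
      have "a * R * (A * B) = b * S * (A * B)" if "a * A = b * B" "A * S = B * R" for a b A B R S :: complex
        using that by algebra
      thus ?thesis using t ex2 by blast
    qed
    thus ?thesis using z0 by simp
  qed
  define y v where "y = z ^ r" and "v = z ^ s"
  have yv: "z * y\<^sup>2 * v\<^sup>2 = 1"
    using z unfolding rs[symmetric] by (simp add: y_def v_def power_mult[symmetric] power_add algebra_simps)
  have nz: "y \<noteq> 0" "v \<noteq> 0" using z0 by (simp_all add: y_def v_def)
  have cr: "root_summand r = (1 - z * y ^ 4) * y * \<tau> r ^ 6" "root_summand s = (1 - z * v ^ 4) * v * \<tau> s ^ 6"
    by (simp_all add: root_summand_def y_def v_def power_mult[symmetric] mult.commute)
  have "v ^ 2 * y ^ 2 * z * root_summand s = - (v ^ 2 * y ^ 2 * z * root_summand r)"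
    using yv t2 unfolding cr y_def[symmetric] v_def[symmetric] by algebra
  hence "v ^ 2 * y ^ 2 * z * root_summand s = v ^ 2 * y ^ 2 * z * - root_summand r" by simp
  moreover have "v ^ 2 * y ^ 2 * z \<noteq> 0" using nz z0 by simp
  ultimately show ?thesis by (metis mult_left_cancel)
qed

lemma sum_antisymmetric:
  fixes f :: "nat \<Rightarrow> complex"
  assumes "\<And>r s. r + s = N \<Longrightarrow> f s = - f r"
  shows "(\<Sum>r\<le>N. f r) = 0"
proof -
  have "(\<Sum>r\<le>N. f r) = (\<Sum>r\<le>N. f (N - r))"
    by (rule sum.reindex_bij_witness[of _ "\<lambda>r. N - r" "\<lambda>r. N - r"]) auto
  also have "\<dots> = - (\<Sum>r\<le>N. f r)"
    unfolding sum_negf[symmetric] by (intro sum.cong refl assms) auto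
  finally show ?thesis by simp
qed

lemma sum_root_summand: "(\<Sum>r\<le>N. root_summand r) = 0"
  by (intro sum_antisymmetric root_summand_reflect)

lemma sum_root_summand_lin_coeff: "(\<Sum>r\<le>N. root_summand r * lin_coeff r) = 0"
proof (rule sum_antisymmetric)
  fix r s assume rs: "r + s = N"
  hence "s = N - r" "r \<le> N" by auto
  thus "root_summand s * lin_coeff s = - (root_summand r * lin_coeff r)" using root_summand_reflect[OF rs] lin_coeff_reflect[of r] by simp
qed

end

subsection \<open>Order of vanishing at a complex number\<close>

abbreviation cpoly :: "rat poly \<Rightarrow> complex poly" where
  "cpoly \<equiv> map_poly of_rat"

lemma cpoly_add: "cpoly (p + r) = cpoly p + cpoly r"
  by (rule poly_eqI) (simp add: coeff_map_poly of_rat_add)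

lemma cpoly_1: "cpoly 1 = 1"
  by (simp add: map_poly_1')

text \<open>
  Membership in the \<open>k\<close>-th power of the maximal ideal of the local ring at \<open>z\<close>; \<open>vanishes z 0\<close> is regularity.
\<close>
definition vanishes :: "complex \<Rightarrow> nat \<Rightarrow> ratfun \<Rightarrow> bool" where
  "vanishes z k A \<longleftrightarrow> (\<exists>a b. A = to_fract a / to_fract b \<and> poly (cpoly b) z \<noteq> 0 \<and> [:-z, 1:] ^ k dvd cpoly a)"

text \<open>A relation instead of an evaluation function: at a pole there is no value, so every
  derived value also proves regularity at z.\<close>

definition has_val :: "complex \<Rightarrow> ratfun \<Rightarrow> complex \<Rightarrow> bool" where
  "has_val z A c \<longleftrightarrow> (\<exists>a b. A = to_fract a / to_fract b \<and> poly (cpoly b) z \<noteq> 0 \<and> c = poly (cpoly a) z / poly (cpoly b) z)"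

lemma vanishesI:
  "A = to_fract a / to_fract b \<Longrightarrow> poly (cpoly b) z \<noteq> 0 \<Longrightarrow> [:-z, 1:] ^ k dvd cpoly a \<Longrightarrow> vanishes z k A"
  by (auto simp: vanishes_def)

lemma has_valI:
  "A = to_fract a / to_fract b \<Longrightarrow> poly (cpoly b) z \<noteq> 0 \<Longrightarrow> c = poly (cpoly a) z / poly (cpoly b) z \<Longrightarrow> has_val z A c"
  by (auto simp: has_val_def)

lemma cpoly_nonzero:
  "poly (cpoly b) z \<noteq> 0 \<Longrightarrow> to_fract b \<noteq> 0"
  by auto

lemma vanishes_add:
  assumes "vanishes z k A" "vanishes z k B"
  shows "vanishes z k (A + B)"
proof -
  obtain a b c d where A: "A = to_fract a / to_fract b" "poly (cpoly b) z \<noteq> 0" "[:-z, 1:] ^ k dvd cpoly a"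
    and B: "B = to_fract c / to_fract d" "poly (cpoly d) z \<noteq> 0" "[:-z, 1:] ^ k dvd cpoly c"
    using assms unfolding vanishes_def by blast
  show ?thesis
  proof (rule vanishesI)
    show "A + B = to_fract (a * d + c * b) / to_fract (b * d)"
      unfolding A(1) B(1) using cpoly_nonzero[OF A(2)] cpoly_nonzero[OF B(2)]
      by (simp add: add_frac_eq)
    show "poly (cpoly (b * d)) z \<noteq> 0" using A(2) B(2) by (simp add: map_poly_of_rat_mult)
    show "[:-z, 1:] ^ k dvd cpoly (a * d + c * b)"
      using A(3) B(3) by (simp add: cpoly_add map_poly_of_rat_mult dvd_add)
  qed
qed

lemma vanishes_mult:
  assumes "vanishes z k A" "vanishes z l B"
  shows "vanishes z (k + l) (A * B)"
proof -
  obtain a b c d where A: "A = to_fract a / to_fract b" "poly (cpoly b) z \<noteq> 0" "[:-z, 1:] ^ k dvd cpoly a"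
    and B: "B = to_fract c / to_fract d" "poly (cpoly d) z \<noteq> 0" "[:-z, 1:] ^ l dvd cpoly c"
    using assms unfolding vanishes_def by blast
  show ?thesis
  proof (rule vanishesI)
    show "A * B = to_fract (a * c) / to_fract (b * d)"
      unfolding A(1) B(1) by simp
    show "poly (cpoly (b * d)) z \<noteq> 0" using A(2) B(2) by (simp add: map_poly_of_rat_mult)
    show "[:-z, 1:] ^ (k + l) dvd cpoly (a * c)"
      using A(3) B(3) by (simp add: power_add map_poly_of_rat_mult mult_dvd_mono)
  qed
qed

lemma vanishes_mono: "vanishes z k A \<Longrightarrow> l \<le> k \<Longrightarrow> vanishes z l A"
  unfolding vanishes_def using dvd_trans[OF le_imp_power_dvd[of l k "[:-z, 1:]"]] by metis

lemma vanishes_0 [simp]: "vanishes z k 0"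
  by (rule vanishesI[of _ 0 1]) (simp_all add: cpoly_1)

lemma has_val_imp_vanishes_0: "has_val z A c \<Longrightarrow> vanishes z 0 A"
  unfolding has_val_def vanishes_def by auto

lemma has_val_imp_vanishes_1: "has_val z A 0 \<Longrightarrow> vanishes z 1 A"
  unfolding has_val_def vanishes_def by (auto simp: poly_eq_0_iff_dvd)

lemma has_val_poly: "has_val z (to_fract p) (poly (cpoly p) z)"
  by (rule has_valI[of _ p 1]) (simp_all add: cpoly_1)

lemma has_val_qvar [intro]: "has_val z qvar z"
  using has_val_poly[of z "monom 1 1"] by (simp add: map_poly_monom poly_monom)

lemma has_val_0 [intro, simp]: "has_val z 0 0" and has_val_1 [intro, simp]: "has_val z 1 1"
  using has_val_poly[of z 0] has_val_poly[of z 1] by (simp_all add: cpoly_1)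

lemma has_val_add [intro]:
  assumes "has_val z A u" "has_val z B v"
  shows "has_val z (A + B) (u + v)"
proof -
  obtain a b c d where A: "A = to_fract a / to_fract b" "poly (cpoly b) z \<noteq> 0" "u = poly (cpoly a) z / poly (cpoly b) z"
    and B: "B = to_fract c / to_fract d" "poly (cpoly d) z \<noteq> 0" "v = poly (cpoly c) z / poly (cpoly d) z"
    using assms unfolding has_val_def by blast
  show ?thesis
  proof (rule has_valI)
    show "A + B = to_fract (a * d + c * b) / to_fract (b * d)"
      unfolding A(1) B(1) using cpoly_nonzero[OF A(2)] cpoly_nonzero[OF B(2)]
      by (simp add: add_frac_eq)
    show "poly (cpoly (b * d)) z \<noteq> 0" using A(2) B(2) by (simp add: map_poly_of_rat_mult)
    show "u + v = poly (cpoly (a * d + c * b)) z / poly (cpoly (b * d)) z"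
      unfolding A(3) B(3) using A(2) B(2) by (simp add: cpoly_add map_poly_of_rat_mult add_frac_eq)
  qed
qed

lemma has_val_mult [intro]:
  assumes "has_val z A u" "has_val z B v"
  shows "has_val z (A * B) (u * v)"
proof -
  obtain a b c d where A: "A = to_fract a / to_fract b" "poly (cpoly b) z \<noteq> 0" "u = poly (cpoly a) z / poly (cpoly b) z"
    and B: "B = to_fract c / to_fract d" "poly (cpoly d) z \<noteq> 0" "v = poly (cpoly c) z / poly (cpoly d) z"
    using assms unfolding has_val_def by blast
  show ?thesis
    by (rule has_valI[of _ "a * c" "b * d"]) (simp_all add: A B map_poly_of_rat_mult)
qed

lemma has_val_of_nat [intro]: "has_val z (of_nat m) (of_nat m)"
  by (induction m) (auto intro: has_val_add)

lemma has_val_numeral [intro]: "has_val z (numeral m) (numeral m)"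
  using has_val_of_nat[of z "numeral m"] by simp

lemma has_val_uminus [intro]: "has_val z A u \<Longrightarrow> has_val z (- A) (- u)"
proof -
  assume "has_val z A u"
  moreover have "cpoly (- 1) = - 1"
    using map_poly_of_rat_diff[of 0 1] by (simp add: cpoly_1)
  hence "has_val z (- 1) (- 1)" using has_val_poly[of z "- 1"] by simp
  ultimately have "has_val z (- 1 * A) (- 1 * u)" by (intro has_val_mult)
  thus ?thesis by simp
qed

lemma has_val_diff [intro]: "has_val z A u \<Longrightarrow> has_val z B v \<Longrightarrow> has_val z (A - B) (u - v)"
  using has_val_add[of z A u "- B" "- v"] has_val_uminus[of z B v] by simp

lemma has_val_power [intro]: "has_val z A u \<Longrightarrow> has_val z (A ^ k) (u ^ k)"
  by (induction k) (auto intro: has_val_mult)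

lemma has_val_sum [intro]: "(\<And>i. i \<in> I \<Longrightarrow> has_val z (f i) (g i)) \<Longrightarrow> has_val z (sum f I) (sum g I)"
  by (induction I rule: infinite_finite_induct) (auto intro: has_val_add)

lemma has_val_prod [intro]: "(\<And>i. i \<in> I \<Longrightarrow> has_val z (f i) (g i)) \<Longrightarrow> has_val z (prod f I) (prod g I)"
  by (induction I rule: infinite_finite_induct) (auto intro: has_val_mult)

lemma has_val_unique: "has_val z A u \<Longrightarrow> has_val z A v \<Longrightarrow> u = v"
proof -
  assume "has_val z A u" "has_val z A v"
  then obtain a b c d where A: "A = to_fract a / to_fract b" "poly (cpoly b) z \<noteq> 0" "u = poly (cpoly a) z / poly (cpoly b) z"
    and B: "A = to_fract c / to_fract d" "poly (cpoly d) z \<noteq> 0" "v = poly (cpoly c) z / poly (cpoly d) z"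
    unfolding has_val_def by blast
  have "to_fract (a * d) = to_fract (c * b)"
    using A(1) B(1) cpoly_nonzero[OF A(2)] cpoly_nonzero[OF B(2)] by (simp add: frac_eq_eq)
  hence "a * d = c * b" by (simp only: to_fract_eq_iff)
  hence "poly (cpoly a) z * poly (cpoly d) z = poly (cpoly c) z * poly (cpoly b) z"
    by (metis map_poly_of_rat_mult poly_mult)
  thus ?thesis using A B by (simp add: frac_eq_eq)
qed

lemma has_val_nonzero: "has_val z A u \<Longrightarrow> u \<noteq> 0 \<Longrightarrow> A \<noteq> 0"
  using has_val_unique[of z 0 u 0] by auto

lemma has_val_inverse:
  assumes "has_val z A u" "u \<noteq> 0"
  shows "has_val z (inverse A) (inverse u)"
proof -
  obtain a b where A: "A = to_fract a / to_fract b" "poly (cpoly b) z \<noteq> 0" "u = poly (cpoly a) z / poly (cpoly b) z"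
    using assms unfolding has_val_def by blast
  show ?thesis
    by (rule has_valI[of _ b a]) (use A assms(2) in auto)
qed

lemma has_val_divide [intro]:
  "has_val z A u \<Longrightarrow> has_val z B v \<Longrightarrow> v \<noteq> 0 \<Longrightarrow> has_val z (A / B) (u / v)"
  unfolding divide_inverse by (intro has_val_mult has_val_inverse)

lemma vanishes_mult_left: "vanishes z k A \<Longrightarrow> vanishes z 0 B \<Longrightarrow> vanishes z k (B * A)"
  using vanishes_mult[of z 0 B k A] by simp

lemma vanishes_mult_right: "vanishes z k A \<Longrightarrow> vanishes z 0 B \<Longrightarrow> vanishes z k (A * B)"
  using vanishes_mult[of z k A 0 B] by simp

lemma vanishes_uminus: "vanishes z k A \<Longrightarrow> vanishes z k (- A)"
  using vanishes_mult_left[of z k A "- 1"] has_val_imp_vanishes_0[OF has_val_uminus[OF has_val_1]] by simp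

lemma vanishes_diff: "vanishes z k A \<Longrightarrow> vanishes z k B \<Longrightarrow> vanishes z k (A - B)"
  using vanishes_add[of z k A "- B"] vanishes_uminus by simp

lemma vanishes_sum: "(\<And>i. i \<in> I \<Longrightarrow> vanishes z k (f i)) \<Longrightarrow> vanishes z k (sum f I)"
  by (induction I rule: infinite_finite_induct) (auto intro: vanishes_add)

lemma vanishes_power: "vanishes z k A \<Longrightarrow> vanishes z (m * k) (A ^ m)"
proof (induction m)
  case 0
  show ?case using has_val_imp_vanishes_0[OF has_val_1] by simp
qed (use vanishes_mult in auto)

lemma vanishes_0_one: "vanishes z 0 1"
  by (rule has_val_imp_vanishes_0[OF has_val_1])

lemma vanishes_0_mult: "vanishes z 0 A \<Longrightarrow> vanishes z 0 B \<Longrightarrow> vanishes z 0 (A * B)"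
  by (rule vanishes_mult_left)

lemma vanishes_0_power: "vanishes z 0 A \<Longrightarrow> vanishes z 0 (A ^ m)"
  using vanishes_power[of z 0 A m] by simp

section \<open>Congruences in the local ring at \<open>z\<close>\<close>

definition vcong :: "complex \<Rightarrow> nat \<Rightarrow> ratfun \<Rightarrow> ratfun \<Rightarrow> bool" where
  "vcong z k A B \<longleftrightarrow> vanishes z k (A - B)"

lemma vcong_refl [intro, simp]: "vcong z k A A"
  by (simp add: vcong_def)

lemma vcong_sym: "vcong z k A B \<Longrightarrow> vcong z k B A"
  unfolding vcong_def using vanishes_uminus[of z k "A - B"] by simp

lemma vcong_trans [trans]: "vcong z k A B \<Longrightarrow> vcong z k B C \<Longrightarrow> vcong z k A C"
  unfolding vcong_def using vanishes_add[of z k "A - B" "B - C"] by simp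

lemma vcong_mult:
  assumes "vcong z k A B" "vcong z k C D" "vanishes z 0 A" "vanishes z 0 D"
  shows "vcong z k (A * C) (B * D)"
proof -
  have "vanishes z k (A * (C - D) + (A - B) * D)"
    using assms unfolding vcong_def by (intro vanishes_add vanishes_mult_left vanishes_mult_right)
  thus ?thesis by (simp add: vcong_def algebra_simps)
qed

lemma vcong_sum: "(\<And>i. i \<in> I \<Longrightarrow> vcong z k (f i) (g i)) \<Longrightarrow> vcong z k (sum f I) (sum g I)"
  unfolding vcong_def sum_subtractf[symmetric] by (rule vanishes_sum)

text \<open>A common factor with a zero raises the precision; with 1 - x as that factor, order 3
  becomes order 4.\<close>

lemma vcong_mult_vanishes:
  assumes "vcong z k B C" "vanishes z l A"
  shows "vcong z (k + l) (A * B) (A * C)"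
  using vanishes_mult[OF assms(2,1)[unfolded vcong_def]] by (simp add: vcong_def right_diff_distrib add.commute)

text \<open>Cross-multiplying two representations of A, the power of the linear factor divides the
  reduced numerator times a polynomial that is nonzero at z and hence coprime to it.\<close>

lemma vanishes_imp_dvd_numerator:
  assumes "vanishes z k A"
  shows "[:-z, 1:] ^ k dvd cpoly (fst (quot_of_fract A))"
proof -
  obtain a b where A: "A = to_fract a / to_fract b" "poly (cpoly b) z \<noteq> 0" "[:-z, 1:] ^ k dvd cpoly a"
    using assms unfolding vanishes_def by blast
  define c d where "c = fst (quot_of_fract A)" and "d = snd (quot_of_fract A)"
  have d0: "d \<noteq> 0" by (simp add: d_def)
  have "A = to_fract c / to_fract d"
    unfolding c_def d_def by (metis Fract_conv_to_fract Fract_quot_of_fract prod.collapse fst_conv snd_conv)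
  hence "to_fract (c * b) = to_fract (a * d)"
    using A(1) d0 cpoly_nonzero[OF A(2)] by (simp add: frac_eq_eq)
  hence "cpoly c * cpoly b = cpoly a * cpoly d"
    by (metis to_fract_eq_iff map_poly_of_rat_mult)
  hence "[:-z, 1:] ^ k dvd cpoly b * cpoly c"
    using A(3) by (simp add: mult.commute)
  moreover have "coprime ([:-z, 1:] ^ k) (cpoly b)"
  proof -
    have "prime_elem [:-z, 1:]" by (intro prime_elem_linear_poly) simp_all
    hence "coprime [:-z, 1:] (cpoly b)"
      using A(2) by (simp add: poly_eq_0_iff_dvd prime_elem_imp_coprime)
    thus ?thesis by simp
  qed
  ultimately show ?thesis by (simp add: c_def coprime_dvd_mult_right_iff)
qed

text \<open>Division with remainder is compatible with the field extension, so a nonzero rational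
  remainder would be a complex multiple of \<open>cpoly p\<close> of smaller degree.\<close>

lemma cpoly_dvd_iff:
  assumes "cpoly p dvd cpoly r"
  shows "p dvd r"
proof (cases "p = 0")
  case True
  hence "cpoly r = cpoly 0" using assms by simp
  hence "r = 0" by (rule map_poly_of_rat_inj)
  thus ?thesis by simp
next
  case False
  have deg: "degree (cpoly s) = degree s" for s by (rule degree_map_poly) simp
  have "cpoly (r mod p) = cpoly r - cpoly p * cpoly (r div p)"
    by (simp add: minus_div_mult_eq_mod[symmetric] map_poly_of_rat_diff map_poly_of_rat_mult mult.commute)
  hence d: "cpoly p dvd cpoly (r mod p)" using assms by simp
  have "r mod p = 0"
  proof (rule ccontr)
    assume nz: "r mod p \<noteq> 0"
    hence "cpoly (r mod p) \<noteq> 0" using map_poly_of_rat_inj[of "r mod p" 0] by auto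
    hence "degree p \<le> degree (r mod p)" using dvd_imp_degree_le[OF d] by (simp add: deg)
    thus False using degree_mod_less[OF False, of r] nz by simp
  qed
  thus ?thesis by (simp add: dvd_eq_mod_eq_0)
qed

text \<open>Powers of distinct linear factors are coprime, so orders of vanishing can be checked one
  root at a time.\<close>

lemma ratfun_congI:
  assumes P: "cpoly P = (\<Prod>z\<in>S. [:-z, 1:] ^ k z)"
    and V: "\<And>z. z \<in> S \<Longrightarrow> vanishes z (k z) (A - B)"
  shows "ratfun_cong A B P"
  unfolding ratfun_cong_def
proof (rule cpoly_dvd_iff, unfold P)
  have "(\<Prod>z\<in>S. [:-z, 1:] ^ k z) dvd r" if "\<And>z. z \<in> S \<Longrightarrow> [:-z, 1:] ^ k z dvd r" for r :: "complex poly"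
    using that
  proof (induction S rule: infinite_finite_induct)
    case (insert s S)
    have "coprime ([:-s, 1:] ^ k s) (\<Prod>z\<in>S. [:-z, 1:] ^ k z)"
    proof (intro prod_coprime_right)
      fix z assume "z \<in> S"
      hence "z \<noteq> s" using insert by auto
      have "prime_elem [:-s, 1:]" by (intro prime_elem_linear_poly) simp_all
      moreover have "\<not> [:-s, 1:] dvd [:-z, 1:]" using \<open>z \<noteq> s\<close> by (simp add: poly_eq_0_iff_dvd[symmetric])
      ultimately have "coprime [:-s, 1:] [:-z, 1:]" by (rule prime_elem_imp_coprime)
      thus "coprime ([:-s, 1:] ^ k s) ([:-z, 1:] ^ k z)" by simp
    qed
    moreover have "[:-s, 1:] ^ k s dvd r" "(\<Prod>z\<in>S. [:-z, 1:] ^ k z) dvd r"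
      using insert by (blast intro: insert.prems)+
    ultimately show ?case unfolding prod.insert[OF insert.hyps] by (intro divides_mult)
  qed auto
  thus "(\<Prod>z\<in>S. [:-z, 1:] ^ k z) dvd cpoly (fst (quot_of_fract (A - B)))"
    by (simp only: V vanishes_imp_dvd_numerator)
qed

subsection \<open>Primitive roots of order \<open>n\<close>\<close>

lemma qvar_power: "qvar ^ i = to_fract (monom 1 i)"
  by (simp add: to_fract_power[symmetric] monom_power)

lemma qvar_nonzero: "qvar \<noteq> 0"
  by simp

lemma qvar_power_neq_1: "i > 0 \<Longrightarrow> qvar ^ i \<noteq> 1"
proof
  assume "i > 0" "qvar ^ i = 1"
  hence "monom 1 i = (1 :: rat poly)" unfolding qvar_power by (metis to_fract_1 to_fract_eq_iff)
  hence "degree (monom 1 i :: rat poly) = 0" by simp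
  thus False using \<open>i > 0\<close> by (simp add: degree_monom_eq)
qed

lemma has_val_qvar_power: "has_val z (qvar ^ j) (z ^ j)"
  by (intro has_val_power has_val_qvar)

lemma has_val_one_minus_power: "has_val z (1 - qvar ^ j) (1 - z ^ j)"
  by (intro has_val_diff has_val_1 has_val_qvar_power)

definition poch_ratio :: "nat \<Rightarrow> ratfun" where
  "poch_ratio r = (\<Prod>i<r. (1 - qvar ^ (2 * i + 1)) / (1 - qvar ^ (2 * i + 2)))"

lemma power_sq_shift:
  fixes x :: "'a::comm_monoid_mult"
  shows "x * (x\<^sup>2) ^ i = x ^ (2 * i + 1)" "x\<^sup>2 * (x\<^sup>2) ^ i = x ^ (2 * i + 2)"
  by (simp_all only: power_add power_mult power_one_right mult.commute[of _ x] mult.commute[of _ "x\<^sup>2"])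

lemma q_poch_odd: "q_poch x (x\<^sup>2) r = (\<Prod>i<r. 1 - x ^ (2 * i + 1))"
  and q_poch_even: "q_poch (x\<^sup>2) (x\<^sup>2) r = (\<Prod>i<r. 1 - x ^ (2 * i + 2))"
  unfolding q_poch_def by (simp_all only: power_sq_shift)

lemma poch_ratio_eq: "q_poch qvar (qvar\<^sup>2) r / q_poch (qvar\<^sup>2) (qvar\<^sup>2) r = poch_ratio r"
  unfolding q_poch_odd q_poch_even poch_ratio_def prod_dividef ..

lemma vcong_prod:
  fixes r :: nat
  assumes "\<And>i. i < r \<Longrightarrow> vcong z k (f i) (g i)"
    and "\<And>i. i < r \<Longrightarrow> vanishes z 0 (f i)" "\<And>i. i < r \<Longrightarrow> vanishes z 0 (g i)"
  shows "vcong z k (\<Prod>i<r. f i) (\<Prod>i<r. g i) \<and> vanishes z 0 (\<Prod>i<r. f i)"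
  using assms
proof (induction r)
  case 0
  show ?case using has_val_imp_vanishes_0[OF has_val_1] by simp
next
  case (Suc r)
  thus ?case using vanishes_mult[of z 0 "\<Prod>i<r. f i" 0 "f r"] by (auto intro!: vcong_mult)
qed

text \<open>
  The numbers \<open>1 / x\<close>, \<open>y\<close>, \<open>x / y\<close> with \<open>y + x / y = x + 1 - (x - 1)\<^sup>2\<close> agree to second order in \<open>t = ln x\<close> with
  \<open>exp (- t \<omega>)\<close> for the three cube roots of unity \<open>\<omega>\<close>, so the linear and quadratic terms in \<open>x - 1\<close> cancel.
\<close>
lemma cubic_odd:
  fixes c x :: "'a::field"
  assumes "x \<noteq> 0"
  shows "(1 - c / x) * (1 - c * (x + 1 - (x - 1)\<^sup>2) + c\<^sup>2 * x) = (1 - c) ^ 3 + c * ((x - 1) ^ 3 / x)"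
  using assms by (simp add: divide_simps) algebra

text \<open>This is \<open>cubic_odd\<close> at 1/c multiplied by -c^3, in accordance with the
  denominator parameters being reciprocal to the numerator ones.\<close>

lemma cubic_even:
  fixes c x :: "'a::field"
  assumes "x \<noteq> 0"
  shows "(1 - c * x) * (1 - c * (x + 1 - (x - 1)\<^sup>2) / x + c\<^sup>2 / x) = (1 - c) ^ 3 - c\<^sup>2 * ((x - 1) ^ 3 / x)"
  using assms by (simp add: divide_simps) algebra

text \<open>The error is quadratic in g; since g has a zero of order 3, it is far below the
  precision 4.\<close>

lemma linearize_quotient:
  fixes u v g a b :: "'a::field"
  assumes "1 - g * b \<noteq> 0"
  shows "(u ^ 3 * (1 + g * a)) / (v ^ 3 * (1 - g * b)) - (u / v) ^ 3 * (1 + g * (a + b))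
     = g ^ 2 * ((u / v) ^ 3 * b * (a + b) / (1 - g * b))"
proof -
  have "(1 + g * a) / (1 - g * b) - (1 + g * (a + b)) = g ^ 2 * (b * (a + b)) / (1 - g * b)"
    using assms by (simp add: divide_simps) algebra
  hence "(u / v) ^ 3 * ((1 + g * a) / (1 - g * b) - (1 + g * (a + b)))
     = (u / v) ^ 3 * (g ^ 2 * (b * (a + b)) / (1 - g * b))" by simp
  thus ?thesis by (simp add: right_diff_distrib power_divide mult_ac)
qed

text \<open>Used with y = h^2, where the error h^4 is below the precision 3.\<close>

lemma linearize_inverse:
  fixes y c :: "'a::field"
  assumes "1 + y * c \<noteq> 0"
  shows "1 / (1 + y * c) - (1 - y * c) = y ^ 2 * (c ^ 2 / (1 + y * c))"
  using assms by (simp add: divide_simps) algebra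

context odd_unity_root
begin

lemma has_val_poch_ratio:
  assumes "r \<le> 2 * N"
  shows "has_val z (poch_ratio r) (\<tau> r)"
  unfolding poch_ratio_def \<tau>_def
  by (intro has_val_prod has_val_divide has_val_one_minus_power) (use even_power_neq_1 assms in auto)

text \<open>Both sides are those of the theorem for n = 2N+1 and M = N, times 1 - q, with [n]^2
  (1-q)^2 written as (1-x)^2.\<close>

lemma vcong_at_primitive_root:
  defines "x \<equiv> qvar ^ (2 * N + 1)"
  shows "vcong z 4 (\<Sum>r\<le>N. (1 - qvar ^ (4 * r + 1)) * qvar ^ r * poch_ratio r ^ 6)
    ((1 - x) / qvar ^ N * ((1 + (1 - x)\<^sup>2 * ((of_nat (2 * N + 1) ^ 2 - 1) / 24))
       * (\<Sum>k\<le>N. qvar ^ (2 * k) * poch_ratio k ^ 4)))"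
proof -
  define q where "q = qvar"
  define o' where "o' = (\<lambda>i. q ^ (2 * i + 1))"
  define e where "e = (\<lambda>i. q ^ (2 * i + 2))"
  define h where "h = x - 1"
  define g where "g = h ^ 3 / x"
  define w where "w = x + 1 - h\<^sup>2"
  have q0: "q \<noteq> 0" unfolding q_def by (rule qvar_nonzero)
  have q1: "q ^ i \<noteq> 1" if "i > 0" for i unfolding q_def using that by (rule qvar_power_neq_1)
  have x0: "x \<noteq> 0" using q0 by (simp add: x_def q_def)
  note reg = has_val_imp_vanishes_0
  have hq: "has_val z (q ^ j) (z ^ j)" for j unfolding q_def by (rule has_val_qvar_power)
  have hx: "has_val z x 1" using hq[of "2 * N + 1"] z by (simp only: x_def q_def)
  have hh: "has_val z h 0" using has_val_diff[OF hx has_val_1] by (simp add: h_def)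
  have h1: "vanishes z 1 h" by (rule has_val_imp_vanishes_1[OF hh])
  have hg: "has_val z g 0"
    using has_val_divide[OF has_val_power[OF hh, of 3] hx] by (simp add: g_def)
  have g3: "vanishes z 3 g"
    using vanishes_mult_right[OF vanishes_power[OF h1, of 3] reg[OF has_val_inverse[OF hx]]]
    by (simp add: g_def divide_inverse)
  have nz: "1 - z ^ (2 * i + 1) \<noteq> 0" "1 - z ^ (2 * i + 2) \<noteq> 0" if "i < N" for i
    using prim[of "2 * i + 1"] prim[of "2 * i + 2"] that by auto
  have ho: "has_val z (1 - o' i) (1 - z ^ (2 * i + 1))" "has_val z (1 - e i) (1 - z ^ (2 * i + 2))" for i
    unfolding o'_def e_def by (intro has_val_diff has_val_1 hq)+
  have ho': "has_val z (o' i) (z ^ (2 * i + 1))" "has_val z (e i) (z ^ (2 * i + 2))" for i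
    unfolding o'_def e_def by (intro hq)+
  define num where "num = (\<lambda>i. (1 - o' i) ^ 3 + o' i * g)"
  define den where "den = (\<lambda>i. (1 - e i) ^ 3 - (e i)\<^sup>2 * g)"
  have hnum: "has_val z (num i) ((1 - z ^ (2 * i + 1)) ^ 3 + z ^ (2 * i + 1) * 0)" for i
    unfolding num_def by (intro has_val_add has_val_mult has_val_power ho ho' hg)
  have hden: "has_val z (den i) ((1 - z ^ (2 * i + 2)) ^ 3 - (z ^ (2 * i + 2))\<^sup>2 * 0)" for i
    unfolding den_def by (intro has_val_diff has_val_mult has_val_power ho ho' hg)
  define a where "a = (\<lambda>i. o' i / (1 - o' i) ^ 3)"
  define b where "b = (\<lambda>i. (e i)\<^sup>2 / (1 - e i) ^ 3)"
  have ha: "has_val z (a i) (z ^ (2 * i + 1) / (1 - z ^ (2 * i + 1)) ^ 3)"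
    and hb: "has_val z (b i) ((z ^ (2 * i + 2))\<^sup>2 / (1 - z ^ (2 * i + 2)) ^ 3)" if "i < N" for i
    unfolding a_def b_def using nz[OF that]
    by (intro has_val_divide has_val_power ho ho'; simp)+
  define Lq where "Lq = (\<lambda>r. \<Sum>i<r. a i + b i)"
  have hL: "has_val z (Lq r) (lin_coeff r)" if "r \<le> N" for r
    unfolding Lq_def lin_coeff_def using that by (intro has_val_sum has_val_add ha hb) auto
  have ht: "has_val z (poch_ratio r) (\<tau> r)" if "r \<le> N" for r using that by (intro has_val_poch_ratio) simp
  \<comment> \<open>The perturbed summand agrees with the original one up to a term linear in \<open>g\<close>, and the sum of these
    terms has one more zero at \<open>z\<close> by antisymmetry.\<close>
  define P where "P = (\<lambda>r. \<Prod>i<r. num i / den i)"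
  have hnd: "\<exists>c. has_val z (num i / den i) c" if "i < N" for i
    using has_val_divide[OF hnum hden[of i]] nz[OF that] by auto
  have P: "vanishes z 0 (P r) \<and> vcong z 4 (P r) (poch_ratio r ^ 3 * (1 + g * Lq r))" if "r \<le> N" for r
    using that
  proof (induction r)
    case 0
    show ?case using reg[OF has_val_1] by (simp add: P_def poch_ratio_def Lq_def)
  next
    case (Suc r)
    hence r: "r < N" by simp
    define s where "s = (1 - o' r) / (1 - e r)"
    have hs: "\<exists>c. has_val z s c"
      using has_val_divide[OF ho(1,2)[of r]] nz[OF r] by (auto simp: s_def)
    have h1gb: "has_val z (1 - g * b r) (1 - 0 * ((z ^ (2 * r + 2))\<^sup>2 / (1 - z ^ (2 * r + 2)) ^ 3))"
      by (intro has_val_diff has_val_1 has_val_mult hg hb r)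
    have gb: "1 - g * b r \<noteq> 0" using has_val_nonzero[OF h1gb] by simp
    have oe: "1 - o' r \<noteq> 0" "1 - e r \<noteq> 0" using has_val_nonzero[OF ho(1)] has_val_nonzero[OF ho(2)] nz[OF r] by blast+
    have nd: "num r = (1 - o' r) ^ 3 * (1 + g * a r)" "den r = (1 - e r) ^ 3 * (1 - g * b r)"
      using oe by (simp_all add: num_def den_def a_def b_def field_simps)
    have reg2: "vanishes z 0 (s ^ 3 * b r * (a r + b r) / (1 - g * b r))"
      using hs ha[OF r] hb[OF r] has_val_divide[OF has_val_mult[OF has_val_mult[OF has_val_power[of z s _ 3] hb[OF r]]
            has_val_add[OF ha[OF r] hb[OF r]]] h1gb] by (auto intro: reg)
    have g6: "vanishes z 4 (g ^ 2)"
      using vanishes_power[OF g3, of 2] by (rule vanishes_mono) simp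
    have c1: "vcong z 4 (num r / den r) (s ^ 3 * (1 + g * (a r + b r)))"
      unfolding vcong_def nd s_def linearize_quotient[OF gb]
      by (rule vanishes_mult_right[OF g6 reg2[unfolded s_def]])
    obtain c where c: "has_val z s c" using hs by blast
    have rg: "vanishes z 0 (s ^ 3 * (1 + g * (a r + b r)))"
      by (intro vanishes_0_mult vanishes_add vanishes_0_power vanishes_0_one reg[OF c] reg[OF hg]
          reg[OF ha[OF r]] reg[OF hb[OF r]])
    have rP: "vanishes z 0 (P (Suc r))"
      using Suc vanishes_mult[of z 0 "P r" 0 "num r / den r"] hnd[OF r] reg by (auto simp: P_def)
    have "vcong z 4 (P r * (num r / den r)) (poch_ratio r ^ 3 * (1 + g * Lq r) * (s ^ 3 * (1 + g * (a r + b r))))"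
      using Suc by (intro vcong_mult c1 rg) auto
    moreover have "vcong z 4 (poch_ratio r ^ 3 * (1 + g * Lq r) * (s ^ 3 * (1 + g * (a r + b r))))
        (poch_ratio (Suc r) ^ 3 * (1 + g * Lq (Suc r)))"
    proof -
      have tS: "poch_ratio (Suc r) = poch_ratio r * s" by (simp add: poch_ratio_def s_def o'_def e_def q_def)
      have LS: "Lq (Suc r) = Lq r + (a r + b r)" by (simp add: Lq_def)
      have "poch_ratio r ^ 3 * (1 + g * Lq r) * (s ^ 3 * (1 + g * (a r + b r))) - poch_ratio (Suc r) ^ 3 * (1 + g * Lq (Suc r))
         = g ^ 2 * (poch_ratio r ^ 3 * s ^ 3 * (Lq r * (a r + b r)))"
        unfolding tS LS by algebra
      moreover have "vanishes z 0 (poch_ratio r ^ 3 * s ^ 3 * (Lq r * (a r + b r)))"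
        by (intro vanishes_0_mult vanishes_add vanishes_0_power reg[OF c] reg[OF ht] reg[OF hL]
            reg[OF ha[OF r]] reg[OF hb[OF r]] less_imp_le[OF r])
      ultimately show ?thesis unfolding vcong_def using vanishes_mult_right[OF g6] by simp
    qed
    ultimately show ?case using rP vcong_trans by (auto simp: P_def)
  qed
  define cq where "cq = (\<lambda>r. (1 - q ^ (4 * r + 1)) * q ^ r)"
  have hc: "has_val z (cq r) ((1 - z ^ (4 * r + 1)) * z ^ r)" for r
    unfolding cq_def by (intro has_val_mult has_val_diff has_val_1 hq)
  have F: "vcong z 4 (\<Sum>r\<le>N. cq r * poch_ratio r ^ 3 * P r) (\<Sum>r\<le>N. cq r * poch_ratio r ^ 6)"
  proof -
    have "vcong z 4 (\<Sum>r\<le>N. cq r * poch_ratio r ^ 3 * P r) (\<Sum>r\<le>N. cq r * poch_ratio r ^ 3 * (poch_ratio r ^ 3 * (1 + g * Lq r)))"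
    proof (intro vcong_sum vcong_mult vcong_refl)
      fix r assume "r \<in> {..N}"
      hence r: "r \<le> N" by simp
      show "vcong z 4 (P r) (poch_ratio r ^ 3 * (1 + g * Lq r))" using P[OF r] by simp
      show "vanishes z 0 (cq r * poch_ratio r ^ 3)" "vanishes z 0 (cq r)" "vanishes z 0 (poch_ratio r ^ 3)"
        by (intro vanishes_0_mult vanishes_0_power reg[OF hc] reg[OF ht] r)+
      show "vanishes z 0 (poch_ratio r ^ 3 * (1 + g * Lq r))"
        by (intro vanishes_0_mult vanishes_add vanishes_0_power vanishes_0_one reg[OF hg] reg[OF hL] reg[OF ht] r)
    qed
    also have "(\<Sum>r\<le>N. cq r * poch_ratio r ^ 3 * (poch_ratio r ^ 3 * (1 + g * Lq r)))
       = (\<Sum>r\<le>N. cq r * poch_ratio r ^ 6) + g * (\<Sum>r\<le>N. cq r * poch_ratio r ^ 6 * Lq r)"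
      unfolding sum_distrib_left sum.distrib[symmetric] by (intro sum.cong refl) algebra
    also have "vcong z 4 \<dots> (\<Sum>r\<le>N. cq r * poch_ratio r ^ 6)"
    proof -
      have "has_val z (\<Sum>r\<le>N. cq r * poch_ratio r ^ 6 * Lq r) (\<Sum>r\<le>N. (1 - z ^ (4 * r + 1)) * z ^ r * \<tau> r ^ 6 * lin_coeff r)"
        by (intro has_val_sum has_val_mult has_val_power hc ht hL) auto
      hence "has_val z (\<Sum>r\<le>N. cq r * poch_ratio r ^ 6 * Lq r) 0"
        using sum_root_summand_lin_coeff by (simp only: root_summand_def)
      from vanishes_mult[OF g3 has_val_imp_vanishes_1[OF this]] show ?thesis
        by (simp add: vcong_def)
    qed
    finally show ?thesis .
  qed
  \<comment> \<open>In \<open>watson_transformation\<close> the perturbed parameters enter through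
    the products A Q and B R, whose factors collapse to \<open>num\<close> and \<open>den\<close> by
    the two cubic identities.\<close>
  define U where "U = q_poch q (q\<^sup>2)"
  define E where "E = q_poch (q\<^sup>2) (q\<^sup>2)"
  define A where "A = q_poch (q / x) (q\<^sup>2)"
  define B where "B = q_poch (q\<^sup>2 * x) (q\<^sup>2)"
  define Q where "Q = quad_poch (q * w) (q\<^sup>2 * x) (q\<^sup>2)"
  define R where "R = quad_poch (q\<^sup>2 * w / x) (q ^ 4 / x) (q\<^sup>2)"
  have tU: "U r / E r = poch_ratio r" for r unfolding U_def E_def q_def by (rule poch_ratio_eq)
  have AQ: "A r * Q r = (\<Prod>i<r. num i)" for r
    unfolding A_def Q_def q_poch_def quad_poch_def prod.distrib[symmetric]
  proof (intro prod.cong refl)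
    fix i
    have es: "q / x * (q\<^sup>2) ^ i = o' i / x" "q * w * (q\<^sup>2) ^ i = o' i * w" "q\<^sup>2 * x * (q\<^sup>2) ^ (2 * i) = (o' i)\<^sup>2 * x"
      unfolding o'_def power_sq_shift(1)[symmetric]
      by (simp_all add: power_mult_distrib power_mult[symmetric] mult_ac)
    show "(1 - q / x * (q\<^sup>2) ^ i) * (1 - q * w * (q\<^sup>2) ^ i + q\<^sup>2 * x * (q\<^sup>2) ^ (2 * i)) = num i"
      unfolding es unfolding num_def g_def h_def w_def by (rule cubic_odd[OF x0])
  qed
  have Rf: "R r = (\<Prod>i<r. 1 - e i * w / x + (e i)\<^sup>2 / x)" for r
    unfolding R_def quad_poch_def
  proof (intro prod.cong refl)
    fix i
    have es: "q\<^sup>2 * w / x * (q\<^sup>2) ^ i = e i * w / x" "q ^ 4 / x * (q\<^sup>2) ^ (2 * i) = (e i)\<^sup>2 / x"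
      unfolding e_def power_sq_shift(2)[symmetric]
      by (simp_all add: power_mult_distrib power_mult[symmetric] mult_ac)
    show "1 - q\<^sup>2 * w / x * (q\<^sup>2) ^ i + q ^ 4 / x * (q\<^sup>2) ^ (2 * i) = 1 - e i * w / x + (e i)\<^sup>2 / x"
      unfolding es ..
  qed
  have BR: "B r * R r = (\<Prod>i<r. den i)" for r
    unfolding B_def Rf q_poch_def prod.distrib[symmetric]
  proof (intro prod.cong refl)
    fix i
    have es: "q\<^sup>2 * x * (q\<^sup>2) ^ i = e i * x"
      unfolding e_def power_sq_shift(2)[symmetric] by (simp add: mult_ac)
    show "(1 - q\<^sup>2 * x * (q\<^sup>2) ^ i) * (1 - e i * w / x + (e i)\<^sup>2 / x) = den i"
      unfolding es unfolding den_def g_def h_def w_def by (rule cubic_even[OF x0])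
  qed
  have hw: "has_val z w 2"
    using has_val_diff[OF has_val_add[OF hx has_val_1] has_val_power[OF hh, of 2]] by (simp add: w_def)
  have hR: "has_val z (1 - e i * w / x + (e i)\<^sup>2 / x) ((1 - z ^ (2 * i + 2))\<^sup>2)" for i
  proof -
    have "has_val z (1 - e i * w / x + (e i)\<^sup>2 / x) (1 - z ^ (2 * i + 2) * 2 / 1 + (z ^ (2 * i + 2))\<^sup>2 / 1)"
      by (intro has_val_add has_val_diff has_val_divide has_val_mult has_val_power has_val_1 ho' hw hx) simp_all
    moreover have "1 - z ^ (2 * i + 2) * 2 / 1 + (z ^ (2 * i + 2))\<^sup>2 / 1 = (1 - z ^ (2 * i + 2))\<^sup>2"
      by (simp add: power2_eq_square algebra_simps)
    ultimately show ?thesis by simp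
  qed
  have R0: "1 - e i * w / x + (e i)\<^sup>2 / x \<noteq> 0" if "i < N" for i
    using has_val_nonzero[OF hR] nz(2)[OF that] by simp
  have RN: "R N \<noteq> 0" unfolding Rf using R0 by simp
  define V where "V = E N * q_poch (q\<^sup>2 / x) (q\<^sup>2) N / R N"
  have PP: "P r = (\<Prod>i<r. num i) / (\<Prod>i<r. den i)" for r
    by (simp add: P_def prod_dividef)
  have watson: "(\<Sum>r\<le>N. cq r * poch_ratio r ^ 3 * P r)
     = (1 - x) * V / q ^ N * (\<Sum>k\<le>N. q ^ (2 * k) * U k * (A k * Q k) / E k ^ 4)"
    using watson_transformation[OF q0 q1, where N = N and w = w] RN
    unfolding x_def[folded q_def, symmetric]
    unfolding A_def[symmetric] B_def[symmetric] U_def[symmetric] E_def[symmetric] Q_def[symmetric] R_def[symmetric]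
      V_def[symmetric] tU AQ BR PP cq_def by simp
  define K where "K = ((of_nat (2 * N + 1) ^ 2 - 1) / 24 :: ratfun)"
  have hK: "has_val z K ((of_nat (2 * N + 1) ^ 2 - 1) / 24)"
    unfolding K_def by (intro has_val_divide has_val_diff has_val_power has_val_of_nat has_val_1 has_val_numeral) simp
  have h4: "vanishes z 3 ((h\<^sup>2)\<^sup>2)"
    using vanishes_power[OF vanishes_power[OF h1, of 2], of 2] by (rule vanishes_mono) simp
  \<comment> \<open>\<open>f i\<close> are the factors of \<open>V\<close> and \<open>d i\<close>
    are the c_i of the overview. Since w = x + 1 - h^2, the denominator of \<open>f i\<close> is
    (1-e)(1-e/x) + h^2 e/x, which gives f = 1 / (1 + h^2 d).\<close>
  define f where "f = (\<lambda>i. (1 - e i) * (1 - e i / x) / (1 - e i * w / x + (e i)\<^sup>2 / x))"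
  define d where "d = (\<lambda>i. e i / (x * (1 - e i) * (1 - e i / x)))"
  have h1ex: "has_val z (1 - e i / x) (1 - z ^ (2 * i + 2))" for i
    using has_val_diff[OF has_val_1 has_val_divide[OF ho'(2)[of i] hx]] by simp
  have hd: "has_val z (d i) (z ^ (2 * i + 2) / (1 - z ^ (2 * i + 2))\<^sup>2)" if "i < N" for i
    using has_val_divide[OF ho'(2)[of i] has_val_mult[OF has_val_mult[OF hx ho(2)[of i]] h1ex[of i]]] nz(2)[OF that]
    by (simp add: d_def power2_eq_square)
  have h1hd: "has_val z (1 + h\<^sup>2 * d i) 1" if "i < N" for i
    using has_val_add[OF has_val_1 has_val_mult[OF has_val_power[OF hh, of 2] hd[OF that]]] by simp
  have f_eq: "f i = 1 / (1 + h\<^sup>2 * d i)" if "i < N" for i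
  proof -
    have n1: "1 - e i \<noteq> 0" "1 - e i / x \<noteq> 0"
      using has_val_nonzero[OF ho(2)] has_val_nonzero[OF h1ex] nz(2)[OF that] by blast+
    have "1 - e i * w / x + (e i)\<^sup>2 / x = (1 - e i) * (1 - e i / x) + h\<^sup>2 * (e i / x)"
      using x0 by (simp add: w_def h_def divide_simps) algebra
    also have "h\<^sup>2 * (e i / x) = (1 - e i) * (1 - e i / x) * (h\<^sup>2 * d i)"
      using n1 x0 by (simp add: d_def)
    finally have "1 - e i * w / x + (e i)\<^sup>2 / x = (1 - e i) * (1 - e i / x) * (1 + h\<^sup>2 * d i)"
      by (simp only: distrib_left mult_1_right)
    thus ?thesis using n1 by (simp add: f_def)
  qed
  have Pi_f: "V = (\<Prod>i<N. f i)"
  proof -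
    have "E N = (\<Prod>i<N. 1 - e i)" unfolding E_def q_poch_even e_def ..
    moreover have "q_poch (q\<^sup>2 / x) (q\<^sup>2) N = (\<Prod>i<N. 1 - e i / x)"
      unfolding q_poch_def e_def by (intro prod.cong refl) (simp only: power_sq_shift(2)[symmetric] times_divide_eq_left)
    ultimately show ?thesis unfolding V_def Rf f_def by (simp only: prod.distrib prod_dividef)
  qed
  have Pc: "vanishes z 0 (\<Prod>i<r. f i) \<and> vcong z 3 (\<Prod>i<r. f i) (1 - h\<^sup>2 * (\<Sum>i<r. d i))" if "r \<le> N" for r
    using that
  proof (induction r)
    case 0
    show ?case using reg[OF has_val_1] by simp
  next
    case (Suc r)
    hence r: "r < N" by simp
    have hD: "\<exists>c. has_val z (\<Sum>i<r. d i) c"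
      using has_val_sum[of "{..<r}" z d "\<lambda>i. z ^ (2 * i + 2) / (1 - z ^ (2 * i + 2))\<^sup>2"] hd r by auto
    have hf: "vanishes z 0 (f r)"
      unfolding f_eq[OF r] by (rule reg, rule has_val_divide[OF has_val_1 h1hd[OF r]]) simp
    have "vanishes z 0 (d r ^ 2 / (1 + h\<^sup>2 * d r))"
      by (rule reg, rule has_val_divide[OF has_val_power[OF hd[OF r]] h1hd[OF r]]) simp
    from vanishes_mult_right[OF h4 this] have c1: "vcong z 3 (f r) (1 - h\<^sup>2 * d r)"
      unfolding vcong_def f_eq[OF r] linearize_inverse[OF has_val_nonzero[OF h1hd[OF r] one_neq_zero]] .
    have rg: "vanishes z 0 (1 - h\<^sup>2 * d r)"
      by (intro vanishes_diff vanishes_0_mult vanishes_0_power vanishes_0_one reg[OF hh] reg[OF hd] r)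
    have "vcong z 3 ((\<Prod>i<r. f i) * f r) ((1 - h\<^sup>2 * (\<Sum>i<r. d i)) * (1 - h\<^sup>2 * d r))"
      using Suc c1 rg by (intro vcong_mult) auto
    also have "vcong z 3 ((1 - h\<^sup>2 * (\<Sum>i<r. d i)) * (1 - h\<^sup>2 * d r)) (1 - h\<^sup>2 * (\<Sum>i<Suc r. d i))"
    proof -
      have "(1 - h\<^sup>2 * (\<Sum>i<r. d i)) * (1 - h\<^sup>2 * d r) - (1 - h\<^sup>2 * (\<Sum>i<Suc r. d i))
          = (h\<^sup>2)\<^sup>2 * ((\<Sum>i<r. d i) * d r)"
        by (simp add: power2_eq_square algebra_simps)
      moreover have "vanishes z 0 ((\<Sum>i<r. d i) * d r)"
        using hD has_val_mult[OF _ hd[OF r]] reg by blast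
      ultimately show ?thesis unfolding vcong_def using vanishes_mult_right[OF h4] by simp
    qed
    finally show ?case using Suc hf vanishes_mult[of z 0 "\<Prod>i<r. f i" 0 "f r"] by simp
  qed
  \<comment> \<open>At z the sum of the \<open>d i\<close> is -K, so replacing it by -K is an error
    of order one, multiplied by h^2.\<close>
  have Pi_cong: "vcong z 3 V (1 + h\<^sup>2 * K)"
  proof -
    have "has_val z ((\<Sum>i<N. d i) + K) ((\<Sum>i<N. z ^ (2 * i + 2) / (1 - z ^ (2 * i + 2))\<^sup>2) + (of_nat (2 * N + 1) ^ 2 - 1) / 24)"
      by (intro has_val_add has_val_sum hd hK) simp
    hence "has_val z ((\<Sum>i<N. d i) + K) 0"
      unfolding sum_unity_root_kernel_even by (simp only: minus_divide_left[symmetric] left_minus)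
    hence v: "vanishes z 1 ((\<Sum>i<N. d i) + K)" by (rule has_val_imp_vanishes_1)
    have "vanishes z 3 (h\<^sup>2 * ((\<Sum>i<N. d i) + K))"
      using vanishes_mult[OF vanishes_power[OF h1, of 2] v] by simp
    hence "vanishes z 3 (- (h\<^sup>2 * ((\<Sum>i<N. d i) + K)))" by (rule vanishes_uminus)
    hence "vcong z 3 (1 - h\<^sup>2 * (\<Sum>i<N. d i)) (1 + h\<^sup>2 * K)"
      unfolding vcong_def by (simp add: algebra_simps)
    with Pc[of N] show ?thesis unfolding Pi_f using vcong_trans by blast
  qed
  \<comment> \<open>\<open>num i\<close> differs from the unperturbed cube by a multiple of g, which
    already has order 3.\<close>
  have H: "vcong z 3 (\<Sum>k\<le>N. q ^ (2 * k) * U k * (A k * Q k) / E k ^ 4) (\<Sum>k\<le>N. q ^ (2 * k) * poch_ratio k ^ 4)"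
  proof (intro vcong_sum)
    fix k assume "k \<in> {..N}"
    hence k: "k \<le> N" by simp
    have hU: "has_val z (U k) (\<Prod>i<k. 1 - z ^ (2 * i + 1))"
      unfolding U_def q_poch_odd using ho(1) unfolding o'_def by (intro has_val_prod)
    have hE: "has_val z (E k) (\<Prod>i<k. 1 - z ^ (2 * i + 2))"
      unfolding E_def q_poch_even using ho(2) unfolding e_def by (intro has_val_prod)
    have E0: "(\<Prod>i<k. 1 - z ^ (2 * i + 2)) \<noteq> 0"
      using nz(2) k by auto
    have "vcong z 3 (num i) ((1 - o' i) ^ 3)" for i
      unfolding vcong_def num_def using vanishes_mult_left[OF g3 reg[OF ho'(1)[of i]]] by simp
    hence "vcong z 3 (A k * Q k) (\<Prod>i<k. (1 - o' i) ^ 3)"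
      unfolding AQ using vcong_prod[of k z 3 num "\<lambda>i. (1 - o' i) ^ 3"] reg[OF hnum] reg[OF has_val_power[OF ho(1)]] by blast
    also have "(\<Prod>i<k. (1 - o' i) ^ 3) = U k ^ 3"
      unfolding U_def q_poch_odd o'_def prod_power_distrib ..
    finally have c: "vcong z 3 (A k * Q k) (U k ^ 3)" .
    have "vcong z 3 (q ^ (2 * k) * U k / E k ^ 4 * (A k * Q k)) (q ^ (2 * k) * U k / E k ^ 4 * U k ^ 3)"
    proof (intro vcong_mult vcong_refl c)
      show "vanishes z 0 (q ^ (2 * k) * U k / E k ^ 4)"
        by (rule reg, rule has_val_divide[OF has_val_mult[OF hq hU] has_val_power[OF hE]]) (use E0 in simp)
      show "vanishes z 0 (U k ^ 3)" by (intro vanishes_0_power reg[OF hU])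
    qed
    thus "vcong z 3 (q ^ (2 * k) * U k * (A k * Q k) / E k ^ 4) (q ^ (2 * k) * poch_ratio k ^ 4)"
      unfolding tU[symmetric] by (simp add: power_divide eval_nat_numeral mult_ac)
  qed
  have hH: "vanishes z 0 (\<Sum>k\<le>N. q ^ (2 * k) * poch_ratio k ^ 4)"
    by (intro vanishes_sum vanishes_0_mult vanishes_0_power[of z "poch_ratio _"] reg[OF hq] reg[OF ht]) simp
  have "vcong z 3 (V * (\<Sum>k\<le>N. q ^ (2 * k) * U k * (A k * Q k) / E k ^ 4))
      ((1 + h\<^sup>2 * K) * (\<Sum>k\<le>N. q ^ (2 * k) * poch_ratio k ^ 4))"
    using Pc[of N] Pi_f by (intro vcong_mult Pi_cong H hH) simp
  moreover have "vanishes z 1 ((1 - x) / q ^ N)"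
  proof (rule has_val_imp_vanishes_1)
    show "has_val z ((1 - x) / q ^ N) 0"
      using has_val_divide[OF has_val_diff[OF has_val_1 hx] hq[of N]] root_nonzero by simp
  qed
  ultimately have "vcong z (3 + 1) ((1 - x) / q ^ N * (V * (\<Sum>k\<le>N. q ^ (2 * k) * U k * (A k * Q k) / E k ^ 4)))
      ((1 - x) / q ^ N * ((1 + h\<^sup>2 * K) * (\<Sum>k\<le>N. q ^ (2 * k) * poch_ratio k ^ 4)))"
    by (rule vcong_mult_vanishes)
  hence "vcong z 4 (\<Sum>r\<le>N. cq r * poch_ratio r ^ 3 * P r)
      ((1 - x) / q ^ N * ((1 + h\<^sup>2 * K) * (\<Sum>k\<le>N. q ^ (2 * k) * poch_ratio k ^ 4)))"
    unfolding watson by (simp add: mult_ac)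
  with vcong_sym[OF F] have "vcong z 4 (\<Sum>r\<le>N. cq r * poch_ratio r ^ 6)
      ((1 - x) / q ^ N * ((1 + h\<^sup>2 * K) * (\<Sum>k\<le>N. q ^ (2 * k) * poch_ratio k ^ 4)))"
    by (rule vcong_trans)
  moreover have "h\<^sup>2 = (1 - x)\<^sup>2" by (simp add: h_def power2_commute)
  ultimately show ?thesis by (simp only: cq_def K_def q_def)
qed

end

subsection \<open>Roots of smaller order\<close>

lemma sum_lessThan_add:
  fixes f :: "nat \<Rightarrow> 'a::comm_monoid_add"
  shows "(\<Sum>k<a + b. f k) = (\<Sum>k<a. f k) + (\<Sum>k<b. f (a + k))"
  by (induction b) (simp_all add: add_ac)

lemma poch_ratio_add:
  "poch_ratio (m + k) = poch_ratio m * (\<Prod>i<k. (1 - qvar ^ (2 * (m + i) + 1)) / (1 - qvar ^ (2 * (m + i) + 2)))"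
  by (induction k) (simp_all add: poch_ratio_def mult_ac)

definition q_summand :: "nat \<Rightarrow> ratfun" where
  "q_summand r = (1 - qvar ^ (4 * r + 1)) * qvar ^ r * poch_ratio r ^ 6"

context odd_unity_root
begin

text \<open>At z the exponents matter only modulo the order 2N+1, so every block of factors has the
  values of the first one.\<close>

lemma has_val_block_ratio:
  assumes "k \<le> 2 * N"
  shows "has_val z (\<Prod>i<k. (1 - qvar ^ (2 * (l * (2 * N + 1) + i) + 1)) / (1 - qvar ^ (2 * (l * (2 * N + 1) + i) + 2))) (\<tau> k)"
  unfolding \<tau>_def
proof (intro has_val_prod has_val_divide)
  fix i assume i: "i \<in> {..<k}"
  have e: "2 * (l * (2 * N + 1) + i) + j = (2 * l) * (2 * N + 1) + (2 * i + j)" for j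
    by (simp add: algebra_simps)
  show "has_val z (1 - qvar ^ (2 * (l * (2 * N + 1) + i) + 1)) (1 - z ^ (2 * i + 1))"
    and "has_val z (1 - qvar ^ (2 * (l * (2 * N + 1) + i) + 2)) (1 - z ^ (2 * i + 2))"
    using has_val_one_minus_power unfolding e by (metis power_mod_order)+
  show "1 - z ^ (2 * i + 2) \<noteq> 0" using even_power_neq_1[of i] i assms by auto
qed

text \<open>In a block of length d = 2N+1 exactly one numerator factor vanishes at z (i = N,
  exponent d(2l+1)) and exactly one denominator factor (i = 2N, exponent d(2l+2)). Cancelling 1 -
  q^d from this pair leaves the finite value (2l+1)/(2l+2).\<close>

lemma vanishes_0_poch_ratio_multiple: "vanishes z 0 (poch_ratio (l * (2 * N + 1)))"
proof (induction l)
  case 0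
  show ?case using vanishes_0_one by (simp add: poch_ratio_def)
next
  case (Suc l)
  define d where "d = 2 * N + 1"
  define num where "num = (\<lambda>i. 1 - qvar ^ (2 * (l * d + i) + 1))"
  define den where "den = (\<lambda>i. 1 - qvar ^ (2 * (l * d + i) + 2))"
  define y where "y = qvar ^ d"
  have y1: "1 - y \<noteq> 0" using qvar_power_neq_1[of d] by (simp add: y_def d_def)
  have hy: "has_val z y 1" using has_val_qvar_power[of z d] z by (simp add: y_def d_def)
  have geo: "has_val z (\<Sum>i<m. y ^ i) (of_nat m)" for m
    using has_val_sum[of "{..<m}" z "\<lambda>i. y ^ i" "\<lambda>i. 1 ^ i"] has_val_power[OF hy] by simp
  have ex: "2 * (l * d + N) + 1 = d * (2 * l + 1)" "2 * (l * d + 2 * N) + 2 = d * (2 * l + 2)"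
    by (simp_all add: d_def algebra_simps)
  have "num N = 1 - y ^ (2 * l + 1)" "den (2 * N) = 1 - y ^ (2 * l + 2)"
    unfolding num_def den_def y_def ex by (simp_all only: power_mult)
  hence nd: "num N / den (2 * N) = (\<Sum>i<2 * l + 1. y ^ i) / (\<Sum>i<2 * l + 2. y ^ i)"
    using y1 by (simp only: one_diff_power_eq) simp
  have "has_val z (num N / den (2 * N)) (of_nat (2 * l + 1) / of_nat (2 * l + 2))"
    unfolding nd by (intro has_val_divide geo) (unfold of_nat_eq_0_iff, simp)
  hence r1: "vanishes z 0 (num N / den (2 * N))" by (rule has_val_imp_vanishes_0)
  have hnum: "has_val z (num i) (1 - z ^ (2 * (l * d + i) + 1))" for i
    unfolding num_def by (rule has_val_one_minus_power)
  have hden: "has_val z (den i) (1 - z ^ (2 * (l * d + i) + 2))" for i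
    unfolding den_def by (rule has_val_one_minus_power)
  have e: "2 * (l * d + i) + 2 = (2 * l) * (2 * N + 1) + (2 * i + 2)" for i
    by (simp add: d_def algebra_simps)
  have den0: "1 - z ^ (2 * (l * d + i) + 2) \<noteq> 0" if "i < 2 * N" for i
    unfolding e power_mod_order using even_power_neq_1[OF that] by simp
  have r2: "vanishes z 0 ((\<Prod>i\<in>{..<d} - {N}. num i) / (\<Prod>i<2 * N. den i))"
    by (rule has_val_imp_vanishes_0, rule has_val_divide[OF has_val_prod[OF hnum] has_val_prod[OF hden]])
       (use den0 in auto)
  have "(\<Prod>i<d. num i / den i) = (\<Prod>i<d. num i) / (\<Prod>i<d. den i)" by (simp add: prod_dividef)
  also have "(\<Prod>i<d. num i) = num N * (\<Prod>i\<in>{..<d} - {N}. num i)"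
    by (rule prod.remove) (simp_all add: d_def)
  also have "(\<Prod>i<d. den i) = (\<Prod>i<2 * N. den i) * den (2 * N)"
    by (simp add: d_def)
  finally have "(\<Prod>i<d. num i / den i)
      = num N / den (2 * N) * ((\<Prod>i\<in>{..<d} - {N}. num i) / (\<Prod>i<2 * N. den i))"
    by simp
  hence "vanishes z 0 (\<Prod>i<d. num i / den i)" using vanishes_0_mult[OF r1 r2] by simp
  moreover have "poch_ratio (Suc l * d) = poch_ratio (l * d) * (\<Prod>i<d. num i / den i)"
    using poch_ratio_add[of "l * d" d] by (simp add: num_def den_def add.commute)
  ultimately show ?case using Suc unfolding d_def[symmetric] by (simp add: vanishes_0_mult)
qed

lemma vanishes_0_poch_ratio: "vanishes z 0 (poch_ratio k)"
proof -
  define d where "d = 2 * N + 1"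
  have "k mod d < d" by (simp add: d_def)
  hence "k mod d \<le> 2 * N" by (simp add: d_def)
  from has_val_imp_vanishes_0[OF has_val_block_ratio[OF this]]
  have "vanishes z 0 (poch_ratio (k div d * d + k mod d))"
    unfolding poch_ratio_add d_def by (intro vanishes_0_mult vanishes_0_poch_ratio_multiple)
  thus ?thesis by simp
qed

lemma \<tau>_eq_0: "k > N \<Longrightarrow> \<tau> k = 0"
  unfolding \<tau>_def using z by (intro prod_zero) auto

lemma sum_root_summand_lessThan:
  assumes "N < k"
  shows "(\<Sum>r<k. root_summand r) = 0"
proof -
  have "(\<Sum>r<k. root_summand r) = (\<Sum>r\<le>N. root_summand r)"
    by (rule sum.mono_neutral_right) (use assms in \<open>auto simp: root_summand_def \<tau>_eq_0\<close>)
  thus ?thesis by (simp add: sum_root_summand)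
qed

text \<open>Apart from the regular factor \<open>poch_ratio (l * d) ^ 6\<close>, the terms of block
  l have the values \<open>root_summand r\<close> at z. A block may be cut off anywhere after its
  middle, because \<open>\<tau>\<close> is zero from there on.\<close>

lemma vanishes_block:
  assumes "N < k" "k \<le> 2 * N + 1"
  shows "vanishes z 1 (\<Sum>r<k. q_summand (l * (2 * N + 1) + r))"
proof -
  define d where "d = 2 * N + 1"
  define \<rho> where "\<rho> = (\<lambda>r. \<Prod>i<r. (1 - qvar ^ (2 * (l * d + i) + 1)) / (1 - qvar ^ (2 * (l * d + i) + 2)))"
  define s where "s = (\<lambda>r. (1 - qvar ^ (4 * (l * d + r) + 1)) * qvar ^ (l * d + r) * \<rho> r ^ 6)"
  have "has_val z (s r) (root_summand r)" if "r < k" for r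
  proof -
    have e: "4 * (l * d + r) + 1 = (4 * l) * d + (4 * r + 1)" by (simp add: algebra_simps)
    have z1: "z ^ (4 * (l * d + r) + 1) = z ^ (4 * r + 1)"
      unfolding e unfolding d_def by (rule power_mod_order)
    have z2: "z ^ (l * d + r) = z ^ r"
      unfolding d_def by (rule power_mod_order)
    have "has_val z (1 - qvar ^ (4 * (l * d + r) + 1)) (1 - z ^ (4 * r + 1))"
      using has_val_one_minus_power[of z "4 * (l * d + r) + 1"] unfolding z1 .
    moreover have "has_val z (qvar ^ (l * d + r)) (z ^ r)"
      using has_val_qvar_power[of z "l * d + r"] unfolding z2 .
    moreover have "has_val z (\<rho> r) (\<tau> r)"
      unfolding \<rho>_def d_def by (rule has_val_block_ratio) (use that assms in simp)
    ultimately show ?thesis unfolding s_def root_summand_def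
      by (intro has_val_mult has_val_power[of z "\<rho> r"])
  qed
  hence "has_val z (\<Sum>r<k. s r) (\<Sum>r<k. root_summand r)" by (intro has_val_sum) simp
  hence "has_val z (\<Sum>r<k. s r) 0" using sum_root_summand_lessThan[OF assms(1)] by simp
  from vanishes_mult_left[OF has_val_imp_vanishes_1[OF this] vanishes_0_power[OF vanishes_0_poch_ratio[of "l * d"], where m = 6]]
  have "vanishes z 1 (poch_ratio (l * d) ^ 6 * (\<Sum>r<k. s r))" .
  also have "poch_ratio (l * d) ^ 6 * (\<Sum>r<k. s r) = (\<Sum>r<k. q_summand (l * d + r))"
    unfolding sum_distrib_left
    by (intro sum.cong refl) (simp add: q_summand_def s_def \<rho>_def poch_ratio_add power_mult_distrib mult_ac)
  finally show ?thesis by (simp only: d_def)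
qed

lemma vanishes_multiple:
  assumes "N < k" "k \<le> 2 * N + 1"
  shows "vanishes z 1 (\<Sum>r<m * (2 * N + 1) + k. q_summand r)"
proof -
  have "vanishes z 1 (\<Sum>r<m * (2 * N + 1). q_summand r)"
  proof (induction m)
    case (Suc m)
    have "vanishes z 1 (\<Sum>r<m * (2 * N + 1) + (2 * N + 1). q_summand r)"
      unfolding sum_lessThan_add[of _ "m * (2 * N + 1)"] by (intro vanishes_add Suc.IH vanishes_block) simp_all
    thus ?case by (simp only: mult_Suc add.commute)
  qed simp
  thus ?thesis unfolding sum_lessThan_add by (intro vanishes_add vanishes_block assms)
qed

text \<open>For N < r \<le> 2N the quotient \<open>poch_ratio r\<close> contains 1 - q^(2N+1) and no
  vanishing denominator, so its sixth power is negligible.\<close>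

lemma vcong_upper_half: "vcong z 4 (\<Sum>r\<le>2 * N. q_summand r) (\<Sum>r\<le>N. q_summand r)"
proof -
  have "{..2 * N} = {..N} \<union> {N<..2 * N}" by auto
  hence "(\<Sum>r\<le>2 * N. q_summand r) - (\<Sum>r\<le>N. q_summand r) = (\<Sum>r\<in>{N<..2 * N}. q_summand r)"
    by (simp only:) (subst sum.union_disjoint, auto)
  moreover have "vanishes z 4 (q_summand r)" if "r \<in> {N<..2 * N}" for r
  proof -
    have "has_val z (poch_ratio r) 0" using has_val_poch_ratio[of r] \<tau>_eq_0[of r] that by simp
    from vanishes_power[OF has_val_imp_vanishes_1[OF this], of 6] have "vanishes z 4 (poch_ratio r ^ 6)"
      by (rule vanishes_mono) simp
    thus ?thesis unfolding q_summand_def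
      by (rule vanishes_mult_left) (intro vanishes_0_mult has_val_imp_vanishes_0[OF has_val_one_minus_power]
          has_val_imp_vanishes_0[OF has_val_qvar_power])
  qed
  ultimately show ?thesis unfolding vcong_def using vanishes_sum[of "{N<..2 * N}" z 4 q_summand] by simp
qed

end

section \<open>The modulus and the combination of the local results\<close>

lemma cpoly_q_int:
  assumes "n > 0"
  shows "cpoly (q_int (monom 1 1) n) = (\<Prod>z\<in>{z. z ^ n = 1} - {1}. [:-z, 1:])"
proof -
  have "(1 - monom 1 1) * q_int (monom 1 1) n = (1 - monom 1 n :: rat poly)"
    using q_int_eq_sum[OF one_minus_monom_neq_0, of n] one_diff_power_eq[of "monom 1 1 :: rat poly" n]
    by (simp add: monom_power)
  hence "(1 - monom 1 1) * cpoly (q_int (monom 1 1) n) = 1 - monom 1 n"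
    by (metis cpoly_1 map_poly_monom map_poly_of_rat_diff map_poly_of_rat_mult of_rat_0 of_rat_1)
  moreover have "[:-1, 1:] = - (1 - monom 1 1 :: complex poly)"
    by (simp add: monom_Suc monom_0 one_pCons)
  ultimately have "[:-1, 1:] * cpoly (q_int (monom 1 1) n) = monom 1 n - 1"
    by (metis mult_minus_left minus_diff_eq)
  also have "\<dots> = (\<Prod>z | z ^ n = 1. [:-z, 1:])" by (rule prod_unity_roots[OF assms, symmetric])
  also have "\<dots> = [:-1, 1:] * (\<Prod>z\<in>{z. z ^ n = 1} - {1}. [:-z, 1:])"
    using finite_roots_unity[of n, where ?'a = complex] assms by (subst prod.remove[of _ 1]) auto
  finally show ?thesis by (metis mult_left_cancel pCons_eq_0_iff one_neq_zero)
qed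

theorem corollary2p2:
  fixes n M :: nat
  assumes "0 < n" and "odd n"
    and "M = (n - 1) div 2 \<or> M = n - 1"
  shows "ratfun_cong
    (\<Sum>k=0..M. q_int qvar (4 * k + 1)
        * (q_poch qvar (qvar ^ 2) k ^ 6 / q_poch (qvar ^ 2) (qvar ^ 2) k ^ 6) * qvar ^ k)
    (q_int qvar n * (qvar powi ((1 - int n) div 2))
        * (1 + q_int qvar n ^ 2 * (((of_nat n ^ 2 - 1) * (1 - qvar) ^ 2) / 24))
        * (\<Sum>k=0..(n - 1) div 2.
            q_poch qvar (qvar ^ 2) k ^ 4 / q_poch (qvar ^ 2) (qvar ^ 2) k ^ 4 * qvar ^ (2 * k)))
    (q_int (monom 1 1) n * cyclotomic n ^ 3)"
    (is "ratfun_cong ?A ?B ?P")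
proof (cases "n = 1")
  \<comment> \<open>For n = 1 both sides coincide. This case is separate because the primitive root
    is then 1, which is not a zero of [n].\<close>
  case True
  hence "?A = ?B" using assms(3) by simp
  thus ?thesis by (simp add: ratfun_cong_def)
next
  case False
  obtain s where n: "n = 2 * s + 1" using assms(2) by (elim oddE)
  have s: "(n - 1) div 2 = s" "n - 1 = 2 * s" "(1 - int n) div 2 = - int s" "s > 0"
    using False by (simp_all add: n)
  define y where "y = 1 - qvar"
  have y0: "y \<noteq> 0" using qvar_power_neq_1[of 1] by (simp add: y_def)
  define x where "x = qvar ^ n"
  define G where "G = (1 - x) / qvar ^ s * ((1 + (1 - x)\<^sup>2 * ((of_nat n ^ 2 - 1) / 24)) * (\<Sum>k\<le>s. qvar ^ (2 * k) * poch_ratio k ^ 4))"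
  have "?A = (\<Sum>k\<le>M. q_summand k * inverse y)"
    unfolding atLeast0AtMost power_divide[symmetric] poch_ratio_eq
    by (intro sum.cong refl) (simp add: q_summand_def q_int_def y_def divide_inverse mult_ac)
  hence A: "?A = (\<Sum>k\<le>M. q_summand k) * inverse y" by (simp only: sum_distrib_right)
  \<comment> \<open>The square (1-q)^2 in the correction term cancels the denominator of [n]^2; a
    single 1/(1-q) remains and is regular at every z other than 1.\<close>
  have rescale: "a / y * b * (1 + (a / y)\<^sup>2 * (m * y\<^sup>2 / 24)) * S = a * b * ((1 + a\<^sup>2 * (m / 24)) * S) * inverse y"
    for a b m S :: ratfun
  proof -
    have "(a / y)\<^sup>2 * (m * y\<^sup>2 / 24) = a\<^sup>2 * (m / 24)" using y0 by (simp add: power_divide)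
    thus ?thesis by (simp only: divide_inverse mult_ac)
  qed
  have B: "?B = G * inverse y"
    unfolding atLeast0AtMost power_divide[symmetric] poch_ratio_eq s(1) s(3) G_def q_int_def y_def[symmetric] x_def[symmetric] rescale
    by (simp only: power_int_minus power_int_of_nat divide_inverse mult.commute[of "poch_ratio _ ^ 4"])
  have AB: "?A - ?B = ((\<Sum>k\<le>M. q_summand k) - G) * inverse y" unfolding A B by (simp add: left_diff_distrib)
  have prim_sub: "primitive_unity_roots n \<subseteq> {z. z ^ n = 1} - {1}"
    using False assms(1) by (auto simp: primitive_unity_roots_def)
  have fin: "finite {z::complex. z ^ n = 1}" using assms(1) by (intro finite_roots_unity) auto
  show ?thesis
  proof (rule ratfun_congI)
    let ?k = "\<lambda>z. if z \<in> primitive_unity_roots n then 4 else 1 :: nat"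
    have "(\<Prod>z\<in>primitive_unity_roots n. [:-z, 1:]) ^ 3
        = (\<Prod>z\<in>{z. z ^ n = 1} - {1}. if z \<in> primitive_unity_roots n then [:-z, 1:] ^ 3 else 1)"
      unfolding prod_power_distrib
      by (rule prod.mono_neutral_cong_left) (use fin prim_sub in auto)
    moreover have "cpoly (p ^ 3) = cpoly p ^ 3" for p
      by (simp add: eval_nat_numeral map_poly_of_rat_mult)
    ultimately have "cpoly ?P = (\<Prod>z\<in>{z. z ^ n = 1} - {1}.
        [:-z, 1:] * (if z \<in> primitive_unity_roots n then [:-z, 1:] ^ 3 else 1))"
      by (simp only: map_poly_of_rat_mult cpoly_q_int[OF assms(1)] of_rat_cyclotomic[OF assms(1)] prod.distrib)
    also have "\<dots> = (\<Prod>z\<in>{z. z ^ n = 1} - {1}. [:-z, 1:] ^ ?k z)"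
      by (intro prod.cong refl) (simp add: eval_nat_numeral)
    finally show "cpoly ?P = (\<Prod>z\<in>{z. z ^ n = 1} - {1}. [:-z, 1:] ^ ?k z)" .
  next
    fix z :: complex assume zS: "z \<in> {z. z ^ n = 1} - {1}"
    then obtain d where d: "d dvd n" "z \<in> primitive_unity_roots d" and z1: "z \<noteq> 1" and zn: "z ^ n = 1"
      using unity_roots_eq_UN[OF assms(1)] by auto
    have "odd d" using d(1) assms(2) by (metis dvd_trans)
    then obtain N where N: "d = 2 * N + 1" by (elim oddE)
    interpret odd_unity_root z N
      by standard (use d(2) in \<open>auto simp: primitive_unity_roots_def N\<close>)
    have ry: "vanishes z 0 (inverse y)"
      unfolding y_def
      by (rule has_val_imp_vanishes_0, rule has_val_inverse[OF has_val_diff[OF has_val_1 has_val_qvar]]) (use z1 in auto)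
    have "vanishes z (if z \<in> primitive_unity_roots n then 4 else 1) ((\<Sum>k\<le>M. q_summand k) - G)"
    proof (cases "z \<in> primitive_unity_roots n")
      case True
      hence "d = n"
        using d disjoint_primitive_unity_roots[of d n] assms(1) \<open>odd d\<close> by (auto simp: N)
      hence sN: "s = N" by (simp add: n N)
      have "vcong z 4 (\<Sum>k\<le>M. q_summand k) (\<Sum>k\<le>N. q_summand k)"
        using assms(3) vcong_upper_half unfolding s sN by auto
      also have "vcong z 4 (\<Sum>k\<le>N. q_summand k) G"
        using vcong_at_primitive_root unfolding G_def x_def q_summand_def n sN by simp
      finally show ?thesis using True by (simp add: vcong_def)
    next
      case False
      obtain t where t: "n = d * t" using d(1) by (elim dvdE)
      have "odd t" using assms(2) t by simp
      then obtain m where m: "t = 2 * m + 1" by (elim oddE)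
      \<comment> \<open>With n = (2m+1)(2N+1), the cut-off (n-1)/2 equals m(2N+1) + N: m full blocks
        and N+1 further terms. The cut-off n - 1 gives 2m+1 full blocks.\<close>
      have "Suc M = m * (2 * N + 1) + Suc N \<or> Suc M = (2 * m) * (2 * N + 1) + (2 * N + 1)"
        using assms(3) unfolding t m N by (auto simp: algebra_simps)
      moreover have "vanishes z 1 (\<Sum>k<m * (2 * N + 1) + Suc N. q_summand k)"
        "vanishes z 1 (\<Sum>k<2 * m * (2 * N + 1) + (2 * N + 1). q_summand k)"
        by (rule vanishes_multiple; simp)+
      ultimately have "vanishes z 1 (\<Sum>k<Suc M. q_summand k)" by metis
      \<comment> \<open>The right-hand side has its zero in 1 - x alone; the other factors only have
        to be regular at z.\<close>
      moreover have "vanishes z 1 G"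
      proof -
        have "has_val z ((1 - x) / qvar ^ s) ((1 - 1) / z ^ s)"
          unfolding x_def using has_val_one_minus_power[of z n] root_nonzero
          by (intro has_val_divide has_val_qvar_power) (simp_all add: zn)
        hence "vanishes z 1 ((1 - x) / qvar ^ s)" by (intro has_val_imp_vanishes_1) simp
        moreover have "vanishes z 0 ((1 + (1 - x)\<^sup>2 * ((of_nat n ^ 2 - 1) / 24)))"
        proof (rule has_val_imp_vanishes_0)
          show "has_val z (1 + (1 - x)\<^sup>2 * ((of_nat n ^ 2 - 1) / 24)) (1 + (1 - z ^ n)\<^sup>2 * ((of_nat n ^ 2 - 1) / 24))"
            unfolding x_def by (intro has_val_add has_val_mult has_val_divide has_val_diff has_val_power has_val_1
                has_val_of_nat has_val_numeral has_val_qvar_power has_val_qvar) simp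
        qed
        moreover have "vanishes z 0 (\<Sum>k\<le>s. qvar ^ (2 * k) * poch_ratio k ^ 4)"
          by (intro vanishes_sum vanishes_0_mult vanishes_0_power[of z "poch_ratio _"] vanishes_0_poch_ratio
              has_val_imp_vanishes_0[OF has_val_qvar_power])
        ultimately show ?thesis unfolding G_def by (intro vanishes_mult_right vanishes_0_mult)
      qed
      ultimately show ?thesis using False by (simp add: vanishes_diff lessThan_Suc_atMost)
    qed
    thus "vanishes z (if z \<in> primitive_unity_roots n then 4 else 1) (?A - ?B)"
      unfolding AB by (rule vanishes_mult_right[OF _ ry])
  qed
qed

end
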